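(* Let $f$ be a primitive (normalised Hecke eigenform) Maass newform of squarefree level $N$, trivial character and Laplace eigenvalue $\lambda=\tfrac14+R^2$, either even or odd, with Fourier coefficients $a_n$ ($a_1=1$). Let $w=\mu(N)\sqrt{N}\prod_{p\mid N}a_p=\prod_{p\mid N}\operatorname{sign}(-a_p)\in\{\pm1\}$, and define, for $y>0$, $$W(y)=\begin{cases}W_{iR}(y)&\text{if } f\text{ is even and }w=-1,\\ W_{iR}(y\sqrt2)-W_{iR}(y/\sqrt2)&\text{if } f\text{ is even and }w=1,\\ \frac{y\sqrt N}{2\pi}W_{iR}(y)&\text{if } f\text{ is odd and }w=1,\\ \frac{y\sqrt N}{2\pi}\left(W_{iR}(y\sqrt2)-\tfrac12W_{iR}(y/\sqrt2)\right)&\text{if } f\text{ is odd and }w=-1,\end{cases}$$ where $W_s(y)=\sqrt{y}\,K_s(y)$ with $K_s$ the $K$-Bessel function. Then $$\sum_{n=1}^\infty\frac{a_n}{\sqrt n}W\Big(\frac{2\pi n}{\sqrt N}\Big)=0,$$ and for every positive integer $M$, $$\left|\sum_{n=M+1}^\infty\frac{a_n}{\sqrt n}W\Big(\frac{2\pi n}{\sqrt N}\Big)\right|\le\begin{cases}\theta\sqrt{\frac{\pi}{2}}\,\dfrac{\exp\left(-\frac{2\pi M}{\sqrt N}\right)}{\exp\left(\frac{2\pi}{\sqrt N}\right)-1}&\text{if } f\text{ is even and }w=-1,\\[3ex] 2\theta\sqrt{\frac{\pi}{2}}\,\dfrac{\exp\left(-\frac{\pi M\sqrt2}{\sqrt N}\right)}{\exp\left(\frac{\pi\sqrt2}{\sqrt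 N}\right)-1}&\text{if } f\text{ is even and }w=1,\\[3ex] \theta\sqrt{\frac{\pi}{2}}\,\dfrac{(M+1)\exp\left(\frac{2\pi}{\sqrt N}\right)-M}{\exp\left(\frac{2\pi M}{\sqrt N}\right)\left(\exp\left(\frac{2\pi}{\sqrt N}\right)-1\right)^2}&\text{if } f\text{ is odd and }w=1,\\[3ex] \frac{3\theta}{2}\sqrt{\frac{\pi}{2}}\,\dfrac{(M+1)\exp\left(\frac{\pi\sqrt2}{\sqrt N}\right)-M}{\exp\left(\frac{\pi M\sqrt2}{\sqrt N}\right)\left(\exp\left(\frac{\pi\sqrt2}{\sqrt N}\right)-1\right)^2}&\text{if } f\text{ is odd and }w=-1.\end{cases}$$
   Context: A Maass cusp form (weight $0$) for $\Gamma_0(N)$ is a non-constant smooth $\Gamma_0(N)$-invariant function on the upper half-plane that lies in $L^2(\Gamma_0(N)\backslash\mathbb{H})$, vanishes at the cusps, and is an eigenfunction of $\Delta=-y^2(\partial_x^2+\partial_y^2)$ (eigenvalue $\lambda=\frac14+R^2>0$). Newforms are those in the orthogonal complement (for the Petersson inner product) of the span of the oldforms $g(kz)$, with $g$ a form for $\Gamma_0(K)$, $K\mid N$, $K<N$, $k\mid N/K$. An even newform (resp. odd newform) has Fourier expansion $$f(z)=\sum_{n=1}^\infty\frac{a_n}{\sqrt n}W_{iR}(2\pi ny)\cos(2\pi nx)\qquad\Big(\text{resp. with }\sin(2\pi nx)\text{ in place of }\cos(2\pi nx)\Big),\quad z=x+iy.$$ Known facts taken as given: by Atkin--Lehner theory,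 $a_p=\pm1/\sqrt p$ for each prime $p\mid N$, and $f(z)=w\,f(-1/(Nz))$ with $w$ as in the claim. By the Kim--Sarnak bound, for primes $p\nmid N$ the Hecke eigenvalue satisfies $a_p=\alpha_p+\alpha_p^{-1}$ with $p^{-7/64}\le|\alpha_p|\le p^{7/64}$ (in particular $|a_p|\le p^{7/64}+p^{-7/64}$). The constant $\theta\approx1.758$ is the resulting bound for $|a_n/\sqrt n|$, namely $$\theta=\sup_{n\ge1}\ \frac{1}{\sqrt n}\prod_{p^k\,\|\,n}\ \sum_{l=0}^{k}p^{\frac{7}{64}(k-2l)},$$ so that $|a_n/\sqrt n|\le\theta$ for all $n\ge1$. *)

theory Defs
  imports "HOL-Analysis.Analysis" "HOL-Computational_Algebra.Computational_Algebra"
begin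

section \<open>The upper half-plane and the groups acting on it\<close>

text \<open>
  Functions on the upper half-plane are represented as functions on \<open>complex\<close>; all notions below
  depend only on their values on \<open>uhp\<close>.
\<close>

definition uhp :: "complex set" where
  "uhp = {z. Im z > 0}"

definition SL2Z :: "(int^2^2) set" where
  "SL2Z = {A. det A = 1}"

definition Gamma0 :: "nat \<Rightarrow> (int^2^2) set" where
  "Gamma0 N = {A \<in> SL2Z. int N dvd A $ 2 $ 1}"

definition mob :: "int^2^2 \<Rightarrow> complex \<Rightarrow> complex" where
  "mob A z = (of_int (A $ 1 $ 1) * z + of_int (A $ 1 $ 2)) /
             (of_int (A $ 2 $ 1) * z + of_int (A $ 2 $ 2))"

section \<open>Smoothness and the hyperbolic Laplacian\<close>

definition partial_x :: "(complex \<Rightarrow> complex) \<Rightarrow> complex \<Rightarrow> complex" where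
  "partial_x f z = vector_derivative (\<lambda>t. f (z + of_real t)) (at 0)"

definition partial_y :: "(complex \<Rightarrow> complex) \<Rightarrow> complex \<Rightarrow> complex" where
  "partial_y f z = vector_derivative (\<lambda>t. f (z + \<i> * of_real t)) (at 0)"

text \<open>Differentiability is in the real sense: \<open>differentiable\<close> asks for a real-linear derivative.\<close>

fun Ck_uhp :: "nat \<Rightarrow> (complex \<Rightarrow> complex) \<Rightarrow> bool" where
  "Ck_uhp 0 f \<longleftrightarrow> continuous_on uhp f"
| "Ck_uhp (Suc k) f \<longleftrightarrow>
     (\<forall>z\<in>uhp. f differentiable (at z)) \<and> Ck_uhp k (partial_x f) \<and> Ck_uhp k (partial_y f)"

definition smooth_uhp :: "(complex \<Rightarrow> complex) \<Rightarrow> bool" where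
  "smooth_uhp f \<longleftrightarrow> (\<forall>k. Ck_uhp k f)"

definition hyp_laplacian :: "(complex \<Rightarrow> complex) \<Rightarrow> complex \<Rightarrow> complex" where
  "hyp_laplacian f z =
     - of_real ((Im z)\<^sup>2) * (partial_x (partial_x f) z + partial_y (partial_y f) z)"

section \<open>Integration over the quotient by \<open>Gamma0 N\<close>\<close>

definition std_fund_dom :: "complex set" where
  "std_fund_dom = {z \<in> uhp. \<bar>Re z\<bar> \<le> 1/2 \<and> norm z \<ge> 1}"

definition Gamma0_cosets :: "nat \<Rightarrow> (int^2^2) set set" where
  "Gamma0_cosets N = (\<lambda>A. (\<lambda>B. B ** A) ` Gamma0 N) ` SL2Z"

text \<open>
  The translates of the standard fundamental domain of \<open>SL2Z\<close> by representatives of the (finitely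
  many) cosets in \<open>Gamma0_cosets N\<close> form a fundamental domain of \<open>Gamma0 N\<close>, and the measure
  \<open>dx dy / y\<^sup>2\<close> is invariant. So for \<open>Gamma0 N\<close>-invariant functions the integral over the quotient is
  the sum below (independent of the choice of representatives), and square integrability over the
  quotient is square integrability of \<open>f \<circ> mob A\<close> over the standard domain for each \<open>A\<close>.
\<close>

definition L2_quotient :: "(complex \<Rightarrow> complex) \<Rightarrow> bool" where
  "L2_quotient f \<longleftrightarrow>
     (\<forall>A\<in>SL2Z. set_integrable lborel std_fund_dom (\<lambda>z. (norm (f (mob A z)))\<^sup>2 / (Im z)\<^sup>2))"

definition petersson :: "nat \<Rightarrow> (complex \<Rightarrow> complex) \<Rightarrow> (complex \<Rightarrow> complex) \<Rightarrow> complex" where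
  "petersson N f g =
     (\<Sum>C\<in>Gamma0_cosets N. let A = (SOME A. A \<in> C) in
        (LINT z:std_fund_dom|lborel. f (mob A z) * cnj (g (mob A z)) / of_real ((Im z)\<^sup>2)))"

section \<open>Maass cusp forms, newforms, Hecke eigenforms\<close>

text \<open>Every cusp is the image of \<open>\<infinity>\<close> under some element of \<open>SL2Z\<close>.\<close>

definition vanishes_at_cusps :: "(complex \<Rightarrow> complex) \<Rightarrow> bool" where
  "vanishes_at_cusps f \<longleftrightarrow>
     (\<forall>A\<in>SL2Z. ((\<lambda>z. f (mob A z)) \<longlongrightarrow> 0) (filtercomap Im at_top))"

definition maass_cusp_form :: "nat \<Rightarrow> real \<Rightarrow> (complex \<Rightarrow> complex) \<Rightarrow> bool" where
  "maass_cusp_form N ev f \<longleftrightarrow>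
     \<not> f constant_on uhp \<and>
     smooth_uhp f \<and>
     (\<forall>A\<in>Gamma0 N. \<forall>z\<in>uhp. f (mob A z) = f z) \<and>
     L2_quotient f \<and>
     vanishes_at_cusps f \<and>
     ev > 0 \<and> (\<forall>z\<in>uhp. hyp_laplacian f z = of_real ev * f z)"

inductive old_span :: "nat \<Rightarrow> (complex \<Rightarrow> complex) \<Rightarrow> bool" for N where
  oldform: "maass_cusp_form K ev g \<Longrightarrow> K dvd N \<Longrightarrow> K < N \<Longrightarrow> k dvd N div K \<Longrightarrow>
              old_span N (\<lambda>z. g (of_nat k * z))"
| zero: "old_span N (\<lambda>z. 0)"
| add: "old_span N g \<Longrightarrow> old_span N h \<Longrightarrow> old_span N (\<lambda>z. g z + h z)"
| scale: "old_span N g \<Longrightarrow> old_span N (\<lambda>z. c * g z)"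

definition maass_newform :: "nat \<Rightarrow> real \<Rightarrow> (complex \<Rightarrow> complex) \<Rightarrow> bool" where
  "maass_newform N ev f \<longleftrightarrow>
     maass_cusp_form N ev f \<and> (\<forall>h. old_span N h \<longrightarrow> petersson N f h = 0)"

text \<open>
  Weight \<open>0\<close> Hecke operator of level \<open>N\<close> and trivial character; for primes \<open>n\<close> dividing \<open>N\<close> this is
  the operator usually called \<open>U\<close>.
\<close>

definition hecke :: "nat \<Rightarrow> nat \<Rightarrow> (complex \<Rightarrow> complex) \<Rightarrow> complex \<Rightarrow> complex" where
  "hecke N n f z = 1 / of_real (sqrt (real n)) *
     (\<Sum>a | a dvd n \<and> coprime a N. \<Sum>b<n div a. f ((of_nat a * z + of_nat b) / of_nat (n div a)))"

definition hecke_eigenform :: "nat \<Rightarrow> (complex \<Rightarrow> complex) \<Rightarrow> bool" where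
  "hecke_eigenform N f \<longleftrightarrow> (\<forall>n\<ge>1. \<exists>c. \<forall>z\<in>uhp. hecke N n f z = c * f z)"

definition even_form :: "(complex \<Rightarrow> complex) \<Rightarrow> bool" where
  "even_form f \<longleftrightarrow> (\<forall>z\<in>uhp. f (- cnj z) = f z)"

definition odd_form :: "(complex \<Rightarrow> complex) \<Rightarrow> bool" where
  "odd_form f \<longleftrightarrow> (\<forall>z\<in>uhp. f (- cnj z) = - f z)"

section \<open>Bessel functions and Fourier expansions\<close>

text \<open>
  The \<open>K\<close>-Bessel function, for \<open>y > 0\<close> and any complex order, by its standard integral
  representation. The order is complex since \<open>R\<close> is imaginary if the eigenvalue is below \<open>1/4\<close>.
\<close>

definition bessel_K :: "complex \<Rightarrow> real \<Rightarrow> complex" where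
  "bessel_K s y = (LINT t:{0..}|lborel. of_real (exp (- y * cosh t)) * cosh (s * of_real t))"

definition whittaker :: "complex \<Rightarrow> real \<Rightarrow> complex" where
  "whittaker s y = of_real (sqrt y) * bessel_K s y"

definition cos_expansion :: "complex \<Rightarrow> (nat \<Rightarrow> complex) \<Rightarrow> (complex \<Rightarrow> complex) \<Rightarrow> bool" where
  "cos_expansion R a f \<longleftrightarrow> (\<forall>z\<in>uhp.
     (\<lambda>m. let n = Suc m in a n / of_real (sqrt (real n)) *
            whittaker (\<i> * R) (2 * pi * real n * Im z) * of_real (cos (2 * pi * real n * Re z)))
     sums f z)"

definition sin_expansion :: "complex \<Rightarrow> (nat \<Rightarrow> complex) \<Rightarrow> (complex \<Rightarrow> complex) \<Rightarrow> bool" where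
  "sin_expansion R a f \<longleftrightarrow> (\<forall>z\<in>uhp.
     (\<lambda>m. let n = Suc m in a n / of_real (sqrt (real n)) *
            whittaker (\<i> * R) (2 * pi * real n * Im z) * of_real (sin (2 * pi * real n * Re z)))
     sums f z)"

section \<open>The quantities in the main statement\<close>

definition moebius_mu :: "nat \<Rightarrow> int" where
  "moebius_mu n = (if squarefree n then (-1) ^ card (prime_factors n) else 0)"

definition theta :: real where
  "theta = (SUP n\<in>{1::nat..}. 1 / sqrt (real n) *
     (\<Prod>p\<in>prime_factors n. \<Sum>l=0..multiplicity p n.
        real p powr (7/64 * (real (multiplicity p n) - 2 * real l))))"

text \<open>The parameter \<open>w\<close> is only used with \<open>w = 1\<close> or \<open>w = -1\<close>.\<close>

definition test_W :: "bool \<Rightarrow> complex \<Rightarrow> nat \<Rightarrow> complex \<Rightarrow> real \<Rightarrow> complex" where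
  "test_W is_even w N R y =
     (if is_even then
        (if w = -1 then whittaker (\<i> * R) y
         else whittaker (\<i> * R) (y * sqrt 2) - whittaker (\<i> * R) (y / sqrt 2))
      else
        (if w = 1 then of_real (y * sqrt (real N) / (2 * pi)) * whittaker (\<i> * R) y
         else of_real (y * sqrt (real N) / (2 * pi)) *
                (whittaker (\<i> * R) (y * sqrt 2) - 1/2 * whittaker (\<i> * R) (y / sqrt 2))))"

end

theory Submission
  imports Defs "HOL-Probability.Distributions" "HOL-Real_Asymp.Real_Asymp"
begin

text \<open>
  Why the series vanishes. The Fricke relation \<open>f z = w * f (- 1 / (N * z))\<close> maps the imaginary axis to
  itself, exchanging the points at height \<open>v\<close> and \<open>1 / (N * v)\<close>. For an even form the Fourier
  series on the axis is the sum of \<open>a n / sqrt n * W (2 * pi * n * v)\<close> with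
  \<open>W = whittaker (\<i> * R)\<close>. If \<open>w = -1\<close>, the fixed
  point \<open>v = 1 / sqrt N\<close> gives \<open>f = 0\<close> there; if \<open>w = 1\<close>, that point says nothing, and one subtracts
  the values at the exchanged heights \<open>sqrt 2 / sqrt N\<close> and \<open>1 / (sqrt 2 * sqrt N)\<close>. An odd form vanishes
  on the axis, and the derivative in the real direction takes the place of the value: the derivative
  of \<open>- 1 / (N * z)\<close> at height \<open>v\<close> is the real number \<open>- 1 / (N * v\<^sup>2)\<close>, which accounts both for the
  sign changes in \<open>w\<close> and for the factor \<open>1 / 2\<close> (\<open>even_series_sums_zero\<close>, \<open>odd_series_sums_zero\<close>).

  Why the tails are small. Comparison with the elementary Bessel function of order \<open>1 / 2\<close> gives
  \<open>norm (whittaker s y) \<le> sqrt (pi / 2) * exp (- y)\<close> whenever \<open>\<bar>Re s\<bar> \<le> 1 / 2\<close>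
  (\<open>norm_whittaker_le\<close>), and positivity of the eigenvalue puts \<open>s = \<i> * R\<close> in this strip. Together
  with \<open>norm (a n / sqrt n) \<le> theta\<close>, the tails are dominated by a geometric series, or by its
  derivative in the odd cases.

  Why \<open>theta\<close> bounds the coefficients. The bounds at primes extend to all indices by the Hecke
  relations, which have to be derived from the eigenform property. Computing the expansion of the Hecke
  transform of \<open>f\<close> (\<open>phase_expansion_hecke\<close>) and comparing it with a multiple of \<open>f\<close> requires that
  the coefficients of an expansion are unique (\<open>phase_expansion_zero_imp\<close>). Only pointwise
  convergence is assumed, so absolute convergence comes first: the terms tend to zero for every
  real part, hence by the Cantor-Lebesgue argument \<open>a n / sqrt n * W (2 * pi * n * y)\<close> tends to
  zero for every \<open>y > 0\<close>; since \<open>W y\<close> is asymptotic to \<open>sqrt (pi / 2) * exp (- y)\<close>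
  (\<open>whittaker_asymptotics\<close>), \<open>a n / sqrt n\<close> grows more slowly than every exponential, and at
  any given height the series is dominated by a geometric one.

  Even and odd forms are treated together by writing \<open>sin x = cos (x - pi / 2)\<close> and allowing an
  arbitrary phase \<open>\<phi>\<close> in \<open>cos (2 * pi * n * x + \<phi>)\<close>.
\<close>

section \<open>The Whittaker function: exponential bound and asymptotics\<close>

lemma set_integral_half_line_open_closed:
  fixes f :: "real \<Rightarrow> 'a :: {banach, second_countable_topology}"
  assumes [measurable]: "f \<in> borel_measurable borel"
  shows "set_integrable lborel {0..} f \<longleftrightarrow> set_integrable lborel {0<..} f"
    and "(LINT t:{0..}|lborel. f t) = (LINT t:{0<..}|lborel. f t)"
proof -
  have ae: "AE x in lborel. indicat_real {0..} x *\<^sub>R f x = indicat_real {0<..} x *\<^sub>R f x"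
    using AE_lborel_singleton[of 0] by eventually_elim (auto simp: indicator_def)
  show "set_integrable lborel {0..} f \<longleftrightarrow> set_integrable lborel {0<..} f"
    unfolding set_integrable_def by (rule integrable_cong_AE[OF _ _ ae]) auto
  show "(LINT t:{0..}|lborel. f t) = (LINT t:{0<..}|lborel. f t)"
    unfolding set_lebesgue_integral_def by (rule integral_cong_AE[OF _ _ ae]) auto
qed

lemma has_bochner_integral_gaussian_scaled:
  assumes "c > 0"
  shows "has_bochner_integral lborel (\<lambda>v. indicat_real {0..} v * exp (- v\<^sup>2 / c\<^sup>2)) (c * sqrt pi / 2)"
proof -
  have "(\<lambda>v. indicat_real {0..} v * exp (- v\<^sup>2 / c\<^sup>2)) =
      (\<lambda>v. indicat_real {0..} (0 + inverse c * v) *\<^sub>R exp (- (0 + inverse c * v)\<^sup>2))"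
    using assms by (auto simp: fun_eq_iff indicator_def zero_le_mult_iff field_simps)
  moreover have "(sqrt pi / 2) /\<^sub>R \<bar>inverse c\<bar> = c * sqrt pi / 2"
    using assms by simp
  moreover have "inverse c \<noteq> 0"
    using assms by simp
  note lborel_has_bochner_integral_real_affine_iff[OF this, THEN iffD1, OF gaussian_moment_0, of 0]
  ultimately show ?thesis
    by (simp only:)
qed

text \<open>
  At order \<open>1 / 2\<close> the integral is elementary: with \<open>v = sqrt (2 * y) * sinh (t / 2)\<close> one has
  \<open>y * cosh t = y + v\<^sup>2\<close>, while the factor \<open>cosh (t / 2)\<close> is absorbed by \<open>dv\<close>, which leaves a Gaussian.
\<close>

lemma bessel_K_half_integral:
  fixes y :: real
  assumes "y > 0"
  shows "set_integrable lborel {0..} (\<lambda>t. exp (- y * cosh t) * cosh (t / 2))"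
    and "(LINT t:{0..}|lborel. exp (- y * cosh t) * cosh (t / 2)) = sqrt (pi / 2) * exp (- y) / sqrt y"
proof -
  define f where "f = (\<lambda>t::real. exp (- y * cosh t) * cosh (t / 2))"
  define r where "r = sqrt (2 * y)"
  define g where "g = (\<lambda>v. 2 * arsinh (v / r))"
  define g' where "g' = (\<lambda>v. 2 / (r * sqrt ((v / r)\<^sup>2 + 1)))"
  have r: "r > 0" "r\<^sup>2 = 2 * y"
    using assms by (auto simp: r_def)
  have dg: "(g has_real_derivative g' v) (at v)" for v
    unfolding g_def g'_def using r
    by (auto intro!: derivative_eq_intros DERIV_chain2[OF arsinh_real_has_field_derivative])
  have fg: "f (g v) * g' v = 2 * exp (- y) / r * exp (- v\<^sup>2)" for v
  proof -
    have "cosh (g v) = 1 + 2 * (v / r)\<^sup>2"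
      unfolding g_def cosh_double_cosh
      by (simp add: cosh_arsinh_real)
    also have "\<dots> = 1 + v\<^sup>2 / y"
      using r by (simp add: power_divide)
    finally have *: "- y * cosh (g v) = - y + - v\<^sup>2"
      using assms by (simp add: field_simps)
    have "cosh (g v / 2) = sqrt ((v / r)\<^sup>2 + 1)"
      by (simp add: g_def cosh_arsinh_real)
    moreover have "sqrt ((v / r)\<^sup>2 + 1) > 0"
      by (simp add: add_nonneg_pos)
    ultimately show ?thesis
      unfolding f_def g'_def * exp_add by simp
  qed
  have gauss: "set_integrable lborel {0<..} (\<lambda>v::real. exp (- v\<^sup>2))"
     "(LINT v:{0<..}|lborel. exp (- v\<^sup>2)) = sqrt pi / 2"
    using gaussian_moment_0 set_integral_half_line_open_closed[of "\<lambda>v::real. exp (- v\<^sup>2)"]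
    by (auto simp: has_bochner_integral_iff set_integrable_def set_lebesgue_integral_def)
  have cont: "isCont f x" for x
    unfolding f_def by (intro continuous_intros) auto
  have contg': "isCont g' x" for x
  proof -
    have "sqrt ((x / r)\<^sup>2 + 1) > 0"
      by (simp add: add_nonneg_pos)
    then show ?thesis
      unfolding g'_def using r by (intro continuous_intros) auto
  qed
  have int: "set_integrable lborel (einterval 0 \<infinity>) (\<lambda>x. f (g x) * g' x)"
    unfolding fg using gauss(1) by (simp add: zero_ereal_def)
  have lim0: "((ereal \<circ> g \<circ> real_of_ereal) \<longlongrightarrow> 0) (at_right 0)"
  proof -
    have "(g \<longlongrightarrow> g 0) (at_right 0)"
      using dg[of 0] by (meson DERIV_isCont isCont_def filterlim_at_split)
    then show ?thesis
      by (simp add: zero_ereal_def ereal_tendsto_simps g_def comp_assoc)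
  qed
  have lim1: "((ereal \<circ> g \<circ> real_of_ereal) \<longlongrightarrow> \<infinity>) (at_left \<infinity>)"
  proof -
    have "filterlim g at_top at_top"
      unfolding g_def using r(1)
      by (intro filterlim_tendsto_pos_mult_at_top[OF tendsto_const] filterlim_compose[OF arsinh_real_at_top])
         (auto simp: divide_inverse mult.commute[of _ "inverse r"] filterlim_ident
           intro!: filterlim_tendsto_pos_mult_at_top[OF tendsto_const])
    then have "((ereal \<circ> g) \<longlongrightarrow> \<infinity>) at_top"
      by (simp add: tendsto_PInfty_eq_at_top comp_def)
    then show ?thesis
      by (simp add: ereal_tendsto_simps)
  qed
  note subst = interval_integral_substitution_nonneg[of 0 \<infinity> g g' f 0 \<infinity>, OF _ dg cont contg' _ _ lim0 lim1 int]
  have 1: "set_integrable lborel {0<..} f"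
    using subst(1) r(1) by (simp add: f_def g'_def zero_ereal_def)
  have 2: "(LINT t:{0<..}|lborel. f t) = 2 * exp (- y) / r * (sqrt pi / 2)"
  proof -
    have "(LINT t:{0<..}|lborel. f t) = (LINT v:{0<..}|lborel. f (g v) * g' v)"
      using subst(2) r(1) by (simp add: f_def g'_def zero_ereal_def interval_lebesgue_integral_def)
    then show ?thesis
      unfolding fg by (simp add: gauss(2))
  qed
  have meas: "f \<in> borel_measurable borel"
    using cont by (intro borel_measurable_continuous_onI) (auto simp: continuous_on_eq_continuous_at)
  show "set_integrable lborel {0..} (\<lambda>t. exp (- y * cosh t) * cosh (t / 2))"
    using 1 set_integral_half_line_open_closed(1)[OF meas] by (simp add: f_def)
  have "(LINT t:{0..}|lborel. f t) = sqrt (pi / 2) * exp (- y) / sqrt y"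
    unfolding set_integral_half_line_open_closed(2)[OF meas] 2 r_def
    by (simp add: real_sqrt_mult real_sqrt_divide field_simps)
  then show "(LINT t:{0..}|lborel. exp (- y * cosh t) * cosh (t / 2)) = sqrt (pi / 2) * exp (- y) / sqrt y"
    by (simp add: f_def)
qed

lemma norm_cosh_le_cosh_half:
  fixes s :: complex and t :: real
  assumes "\<bar>Re s\<bar> \<le> 1 / 2"
  shows "norm (cosh (s * of_real t)) \<le> cosh (t / 2)"
proof -
  have "norm (cosh (s * of_real t)) \<le> (exp (Re s * t) + exp (- (Re s * t))) / 2"
    unfolding cosh_def scaleR_conv_of_real norm_mult
    using norm_triangle_ineq[of "exp (s * of_real t)" "exp (- (s * of_real t))"] by (simp)
  also have "\<dots> = cosh (Re s * t)"
    by (simp add: cosh_def)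
  also have "\<dots> = cosh \<bar>Re s * t\<bar>"
    by simp
  also have "\<dots> \<le> cosh \<bar>t / 2\<bar>"
    using mult_right_mono[OF assms, of "\<bar>t\<bar>"]
    by (subst cosh_real_nonneg_le_iff) (auto simp: abs_mult)
  also have "\<dots> = cosh (t / 2)"
    by (subst cosh_real_abs) (rule refl)
  finally show ?thesis .
qed

text \<open>
  In the strip \<open>\<bar>Re s\<bar> \<le> 1 / 2\<close> the integrand is dominated by the one of order \<open>1 / 2\<close>, whose
  integral is known exactly.
\<close>

lemma norm_whittaker_le:
  assumes "\<bar>Re s\<bar> \<le> 1 / 2" "y > 0"
  shows "norm (whittaker s y) \<le> sqrt (pi / 2) * exp (- y)"
proof -
  have "norm (bessel_K s y) \<le> (LINT t:{0..}|lborel. exp (- y * cosh t) * cosh (t / 2))"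
    unfolding bessel_K_def set_lebesgue_integral_def
  proof (rule Bochner_Integration.integral_norm_bound_integral)
    show i: "integrable lborel (\<lambda>x. indicat_real {0..} x *\<^sub>R (exp (- y * cosh x) * cosh (x / 2)))"
      using bessel_K_half_integral(1)[OF assms(2)] by (simp add: set_integrable_def)
    show le: "norm (indicat_real {0..} x *\<^sub>R (complex_of_real (exp (- y * cosh x)) * cosh (s * of_real x)))
         \<le> indicat_real {0..} x *\<^sub>R (exp (- y * cosh x) * cosh (x / 2))" for x
      using norm_cosh_le_cosh_half[OF assms(1), of x] by (auto simp: indicator_def norm_mult)
    have meas: "(\<lambda>x. complex_of_real (exp (- y * cosh x)) * cosh (s * of_real x)) \<in> borel_measurable borel"
      by (intro borel_measurable_continuous_onI continuous_intros)
    show "integrable lborel (\<lambda>x. indicat_real {0..} x *\<^sub>R (complex_of_real (exp (- y * cosh x)) * cosh (s * of_real x)))"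
      by (intro Bochner_Integration.integrable_bound[OF i] always_eventually allI order_trans[OF le])
        (simp_all only: abs_ge_self real_norm_def, rule borel_measurable_scaleR, simp, use meas in simp)
  qed
  then have "norm (bessel_K s y) \<le> sqrt (pi / 2) * exp (- y) / sqrt y"
    using bessel_K_half_integral(2)[OF assms(2)] by simp
  then show ?thesis
    using assms(2) by (simp add: whittaker_def norm_mult field_simps)
qed

lemma cosh_ge_quadratic: "1 + x\<^sup>2 / 2 \<le> cosh (x::real)"
proof -
  have "\<bar>x / 2\<bar> \<le> sinh \<bar>x / 2\<bar>"
    using real_le_abs_sinh[of "\<bar>x / 2\<bar>"] real_le_x_sinh[of "\<bar>x / 2\<bar>"] by (simp add: sinh_field_def exp_minus field_simps)
  then have "\<bar>x / 2\<bar>\<^sup>2 \<le> (sinh \<bar>x / 2\<bar>)\<^sup>2"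
    by (intro power_mono) auto
  moreover have "cosh x = 1 + 2 * (sinh \<bar>x / 2\<bar>)\<^sup>2"
    using cosh_double_cosh[of "\<bar>x / 2\<bar>"] by (simp add: cosh_square_eq abs_mult)
  ultimately show ?thesis by (simp add: power_divide)
qed

text \<open>
  After the substitution \<open>t = v / sqrt y\<close> the integrand converges to the Gaussian
  \<open>exp (- v\<^sup>2 / 2)\<close>. The lower bound for \<open>cosh\<close> and \<open>cosh (v / 2) \<le> exp (v / 2)\<close> provide an integrable
  majorant that does not depend on \<open>y \<ge> 1\<close>.
\<close>

lemma whittaker_asymptotics:
  assumes "\<bar>Re s\<bar> \<le> 1 / 2"
  shows "((\<lambda>y. of_real (exp y) * whittaker s y) \<longlongrightarrow> of_real (sqrt (pi / 2))) at_top"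
proof -
  define F where "F = (\<lambda>y v. indicat_real {0..} v *\<^sub>R
     (complex_of_real (exp (- y * (cosh (v / sqrt y) - 1))) * cosh (s * of_real (v / sqrt y))))"
  have eq: "of_real (exp y) * whittaker s y = (LINT v|lborel. F y v)" if "y > 0" for y
  proof -
    have "(LINT v|lborel. F y v) = sqrt y *\<^sub>R (LINT x|lborel. F y (0 + sqrt y * x))"
      using lborel_integral_real_affine[of "sqrt y" "F y" 0] that by simp
    also have "(\<lambda>x. F y (0 + sqrt y * x)) = (\<lambda>x. of_real (exp y) * (indicat_real {0..} x *\<^sub>R
        (of_real (exp (- y * cosh x)) * cosh (s * of_real x))))"
    proof
      fix x
      have "s * of_real (sqrt y * x / sqrt y) = s * of_real x"
        using that by simp
      moreover have "exp (- y * (cosh (sqrt y * x / sqrt y) - 1)) = exp y * exp (- y * cosh x)"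
        using that by (simp flip: exp_add add: algebra_simps)
      ultimately show "F y (0 + sqrt y * x) = of_real (exp y) * (indicat_real {0..} x *\<^sub>R
          (of_real (exp (- y * cosh x)) * cosh (s * of_real x)))"
        using that unfolding F_def by (auto simp: indicator_def zero_le_mult_iff)
    qed
    finally show ?thesis
      by (simp add: whittaker_def bessel_K_def set_lebesgue_integral_def scaleR_conv_of_real)
  qed
  have "((\<lambda>y. LINT v|lborel. F y v) \<longlongrightarrow> (LINT v|lborel. complex_of_real (indicat_real {0..} v * exp (- v\<^sup>2 / 2)))) at_top"
  proof (rule integral_dominated_convergence_at_top)
    show "integrable lborel (\<lambda>v. indicat_real {0..} v * (exp (1/4) * exp (- v\<^sup>2 / 4)))"
      using has_bochner_integral_gaussian_scaled[of 2]
      by (auto simp: has_bochner_integral_iff mult.left_commute[of _ "exp (1/4)"])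
    show "\<forall>\<^sub>F y in at_top. AE v in lborel. norm (F y v) \<le> indicat_real {0..} v * (exp (1/4) * exp (- v\<^sup>2 / 4))"
      using eventually_ge_at_top[of 1]
    proof eventually_elim
      case (elim y)
      have "norm (F y v) \<le> indicat_real {0..} v * (exp (1/4) * exp (- v\<^sup>2 / 4))" for v
      proof (cases "v \<ge> 0")
        case True
        have "v\<^sup>2 / 2 \<le> y * (cosh (v / sqrt y) - 1)"
          using cosh_ge_quadratic[of "v / sqrt y"] elim by (simp add: field_simps)
        then have "exp (- y * (cosh (v / sqrt y) - 1)) \<le> exp (- v\<^sup>2 / 2)"
          by simp
        moreover have "norm (cosh (s * of_real (v / sqrt y))) \<le> exp (v / 2)"
        proof -
          have "norm (cosh (s * of_real (v / sqrt y))) \<le> cosh (v / sqrt y / 2)"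
            by (rule norm_cosh_le_cosh_half[OF assms])
          also have "\<dots> \<le> cosh (v / 2)"
            using True elim by (subst cosh_real_nonneg_le_iff) (auto simp: divide_le_eq mult_le_cancel_left1)
          also have "\<dots> \<le> exp (v / 2)"
            using True by (simp add: cosh_def)
          finally show ?thesis .
        qed
        ultimately have "norm (F y v) \<le> exp (- v\<^sup>2 / 2) * exp (v / 2)"
          using True unfolding F_def by (auto simp: norm_mult intro!: mult_mono)
        also have "\<dots> \<le> exp (1/4) * exp (- v\<^sup>2 / 4)"
        proof -
          have "0 \<le> (v / 2 - 1 / 2)\<^sup>2" by simp
          then show ?thesis by (simp flip: exp_add add: power2_eq_square field_simps)
        qed
        finally show ?thesis using True by simp
      qed (auto simp: F_def)
      then show ?case by simp
    qed
    have "((\<lambda>y. F y v) \<longlongrightarrow> complex_of_real (indicat_real {0..} v * exp (- v\<^sup>2 / 2))) at_top" for v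
    proof -
      have 0: "((\<lambda>y. v / sqrt y) \<longlongrightarrow> 0) at_top"
        by real_asymp
      have "((\<lambda>y. y * (cosh (v / sqrt y) - 1)) \<longlongrightarrow> v\<^sup>2 / 2) at_top"
        unfolding cosh_def scaleR_conv_of_real power2_eq_square by real_asymp
      then have "((\<lambda>y. F y v) \<longlongrightarrow> indicat_real {0..} v *\<^sub>R (complex_of_real (exp (- (v\<^sup>2 / 2))) * cosh (s * of_real 0))) at_top"
        unfolding F_def minus_mult_left[symmetric]
        by (intro tendsto_intros 0)
      then show ?thesis by (auto simp: indicator_def)
    qed
    then show "AE v in lborel. ((\<lambda>y. F y v) \<longlongrightarrow> complex_of_real (indicat_real {0..} v * exp (- v\<^sup>2 / 2))) at_top"
      by simp
    show "F y \<in> borel_measurable lborel" for y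
    proof -
      have [measurable]: "(\<lambda>v. cosh (s * of_real (v / sqrt y))) \<in> borel_measurable borel"
        "(\<lambda>v. exp (- y * (cosh (v / sqrt y) - 1))) \<in> borel_measurable borel"
        unfolding divide_inverse by (intro borel_measurable_continuous_onI continuous_intros)+
      show ?thesis unfolding F_def by measurable
    qed
  qed auto
  also have "(LINT v|lborel. complex_of_real (indicat_real {0..} v * exp (- v\<^sup>2 / 2))) = of_real (sqrt (pi / 2))"
  proof -
    have "(LINT v|lborel. indicat_real {0..} v * exp (- v\<^sup>2 / 2)) = sqrt 2 * sqrt pi / 2"
      using has_bochner_integral_gaussian_scaled[of "sqrt 2"] by (simp add: has_bochner_integral_iff)
    also have "sqrt 2 * sqrt pi / 2 = sqrt (2 * pi / 2\<^sup>2)"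
      by (simp only: real_sqrt_divide real_sqrt_mult real_sqrt_abs abs_numeral)
    finally show ?thesis
      by (simp add: integral_complex_of_real del: of_real_mult)
  qed
  finally show ?thesis
  proof (rule Lim_transform_eventually)
    show "\<forall>\<^sub>F y in at_top. (LINT v|lborel. F y v) = of_real (exp y) * whittaker s y"
      using eventually_gt_at_top[of 0] by eventually_elim (simp only: eq)
  qed
qed

section \<open>Cosine series with a phase\<close>

lemma has_bochner_integral_cos_phase:
  fixes j :: int
  shows "has_bochner_integral lborel (\<lambda>x. cos (2 * pi * of_int j * x + \<psi>) * indicat_real {0..1} x)
     (if j = 0 then cos \<psi> else 0)"
proof (cases "j = 0")
  case True
  have "has_bochner_integral lborel (\<lambda>x::real. cos \<psi> * indicat_real {0..1} x) (cos \<psi> * 1 - cos \<psi> * 0)"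
    using has_bochner_integral_FTC_Icc_real[of 0 1 "\<lambda>x. cos \<psi> * x" "\<lambda>x. cos \<psi>"]
    by (auto intro!: derivative_eq_intros)
  with True show ?thesis by simp
next
  case False
  have "has_bochner_integral lborel (\<lambda>x. cos (2 * pi * of_int j * x + \<psi>) * indicat_real {0..1} x)
      (sin (2 * pi * of_int j * 1 + \<psi>) / (2 * pi * of_int j) - sin (2 * pi * of_int j * 0 + \<psi>) / (2 * pi * of_int j))"
    using False by (intro has_bochner_integral_FTC_Icc_real) (auto intro!: derivative_eq_intros continuous_intros)
  moreover have "sin (2 * pi * of_int j * 1 + \<psi>) = sin \<psi>"
    using sin_int_2pin[of j] cos_int_2pin[of j] by (simp add: sin_add)
  ultimately show ?thesis using False by simp
qed

text \<open>
  The phase survives only in the term of frequency \<open>m + k\<close>. This frequency is not zero because both indices are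
  positive, so one orthogonality relation serves sine and cosine series alike.
\<close>

lemma has_bochner_integral_cos_phase_orthogonal:
  fixes m k :: nat
  assumes "m > 0" "k > 0"
  shows "has_bochner_integral lborel
     (\<lambda>x. indicat_real {0..1} x * (cos (2 * pi * real m * x + \<phi>) * cos (2 * pi * real k * x + \<phi>)))
     (if m = k then 1 / 2 else 0)"
proof -
  have eq: "indicat_real {0..1} x * (cos (2 * pi * real m * x + \<phi>) * cos (2 * pi * real k * x + \<phi>)) =
     (cos (2 * pi * of_int (int m - int k) * x + 0) * indicat_real {0..1} x +
      cos (2 * pi * of_int (int m + int k) * x + 2 * \<phi>) * indicat_real {0..1} x) / 2" for x
    unfolding cos_times_cos by (simp add: algebra_simps)
  have "has_bochner_integral lborel (\<lambda>x. (cos (2 * pi * of_int (int m - int k) * x + 0) * indicat_real {0..1} x +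
      cos (2 * pi * of_int (int m + int k) * x + 2 * \<phi>) * indicat_real {0..1} x) / 2)
      (((if int m - int k = 0 then cos 0 else 0) + (if int m + int k = 0 then cos (2 * \<phi>) else 0)) / 2)"
    by (intro has_bochner_integral_divide_zero has_bochner_integral_add has_bochner_integral_cos_phase)
  moreover have "((if int m - int k = 0 then cos 0 else 0) + (if int m + int k = 0 then cos (2 * \<phi>) else 0)) / 2
     = (if m = k then 1 / 2 else (0::real))"
    using assms by auto
  ultimately show ?thesis by (simp only: eq)
qed

text \<open>
  If the coefficients are truncated to absolute value at most \<open>1\<close>, dominated convergence applies to
  the squares of the terms, and the integral of the squared cosine over a period is \<open>1 / 2\<close>
  for every frequency.
\<close>

lemma cantor_lebesgue:
  fixes c :: "nat \<Rightarrow> complex"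
  assumes lim: "\<And>x. (\<lambda>n. c n * of_real (cos (2 * pi * real (Suc n) * x + \<phi>))) \<longlonglongrightarrow> 0"
  shows "c \<longlonglongrightarrow> 0"
proof -
  \<comment> \<open>The truncation supplies the majorant; it still detects whether \<open>c\<close> tends to zero.\<close>
  define d where "d = (\<lambda>n. (min 1 (norm (c n)))\<^sup>2)"
  define h where "h = (\<lambda>n x. cos (2 * pi * real (Suc n) * x + \<phi>))"
  have d: "0 \<le> d n" "d n \<le> 1" for n
    unfolding d_def by (auto simp: power_le_one)
  have "(\<lambda>n. LINT x|lborel. d n * (indicat_real {0..1} x * (h n x * h n x))) \<longlonglongrightarrow> (LINT x::real|lborel. 0)"
  proof (rule integral_dominated_convergence)
    show "integrable lborel (indicat_real {0..1::real})"
      by simp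
    show "AE x in lborel. norm (d n * (indicat_real {0..1} x * (h n x * h n x))) \<le> indicat_real {0..1} x" for n
    proof (intro always_eventually allI)
      fix x
      have "d n * (h n x)\<^sup>2 \<le> 1 * 1"
        using d[of n] by (intro mult_mono) (auto simp: h_def abs_square_le_1)
      then show "norm (d n * (indicat_real {0..1} x * (h n x * h n x))) \<le> indicat_real {0..1} x"
        using d[of n] by (auto simp: indicator_def power2_eq_square)
    qed
    have "(\<lambda>n. d n * (indicat_real {0..1} x * (h n x * h n x))) \<longlonglongrightarrow> 0" for x
    proof (rule Lim_null_comparison)
      show "\<forall>\<^sub>F n in sequentially. norm (d n * (indicat_real {0..1} x * (h n x * h n x)))
          \<le> (norm (c n * of_real (h n x)))\<^sup>2"
      proof (intro always_eventually allI)
        fix n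
        have "d n \<le> (norm (c n))\<^sup>2"
          unfolding d_def by (intro power_mono) auto
        then have "d n * (h n x)\<^sup>2 \<le> (norm (c n))\<^sup>2 * (h n x)\<^sup>2"
          by (intro mult_right_mono) auto
        then show "norm (d n * (indicat_real {0..1} x * (h n x * h n x))) \<le> (norm (c n * of_real (h n x)))\<^sup>2"
          using d[of n] by (auto simp: indicator_def power2_eq_square norm_mult algebra_simps abs_mult)
      qed
      show "(\<lambda>n. (norm (c n * of_real (h n x)))\<^sup>2) \<longlonglongrightarrow> 0"
        using tendsto_power[OF tendsto_norm[OF lim[of x]], of 2] by (simp add: h_def)
    qed
    then show "AE x in lborel. (\<lambda>n. d n * (indicat_real {0..1} x * (h n x * h n x))) \<longlonglongrightarrow> 0"
      by simp
  qed (auto simp: h_def)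
  moreover have "(LINT x|lborel. d n * (indicat_real {0..1} x * (h n x * h n x))) = d n / 2" for n
    using has_bochner_integral_integral_eq[OF has_bochner_integral_cos_phase_orthogonal[of "Suc n" "Suc n" \<phi>]]
    by (simp add: h_def del: of_nat_Suc)
  ultimately have "(\<lambda>n. d n / 2) \<longlonglongrightarrow> 0" by (simp only: integral_zero)
  then have "(\<lambda>n. sqrt (2 * (d n / 2))) \<longlonglongrightarrow> sqrt (2 * 0)"
    by (intro tendsto_intros)
  then have m: "(\<lambda>n. min 1 (norm (c n))) \<longlonglongrightarrow> 0"
    by (simp add: d_def real_sqrt_abs)
  have "\<forall>\<^sub>F n in sequentially. min 1 (norm (c n)) < 1"
    using order_tendstoD(2)[OF m, of 1] by simp
  then have "\<forall>\<^sub>F n in sequentially. min 1 (norm (c n)) = norm (c n)"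
    by eventually_elim auto
  from Lim_transform_eventually[OF m this] show ?thesis
    by (rule tendsto_norm_zero_cancel)
qed

lemma cos_series_coefficients_zero:
  fixes e :: "nat \<Rightarrow> complex"
  assumes summ: "summable (\<lambda>m. norm (e (Suc m)))"
    and zero: "\<And>x. (\<lambda>m. e (Suc m) * of_real (cos (2 * pi * real (Suc m) * x + \<phi>))) sums 0"
    and "k > 0"
  shows "e k = 0"
proof -
  define h where "h = (\<lambda>m x. cos (2 * pi * real m * x + \<phi>))"
  define g where "g = (\<lambda>m x. e (Suc m) * of_real (indicat_real {0..1} x * (h (Suc m) x * h k x)))"
  have hb: "has_bochner_integral lborel (g m) (e (Suc m) * of_real (if Suc m = k then 1 / 2 else 0))" for m
    unfolding g_def h_def using assms(3)
    by (intro has_bochner_integral_mult_right has_bochner_integral_of_real has_bochner_integral_cos_phase_orthogonal) auto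
  have bound: "norm (g m x) \<le> indicat_real {0..1} x * norm (e (Suc m))" for m x
  proof -
    have "\<bar>h (Suc m) x * h k x\<bar> \<le> 1 * 1"
      unfolding abs_mult h_def by (intro mult_mono) auto
    then show ?thesis
      by (auto simp: g_def norm_mult indicator_def mult_left_le abs_mult)
  qed
  have "(\<lambda>m. integral\<^sup>L lborel (g m)) sums (LINT x|lborel. (\<Sum>m. g m x))"
  proof (rule sums_integral)
    show int: "integrable lborel (g m)" for m
      using hb by (simp add: has_bochner_integral_iff)
    have "norm (g m x) \<le> norm (e (Suc m))" for m x
      using bound[of m x] by (cases "x \<in> {0..1}") auto
    then have "summable (\<lambda>m. norm (g m x))" for x
      by (intro summable_comparison_test[OF _ summ]) auto
    then show "AE x in lborel. summable (\<lambda>m. norm (g m x))"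
      by simp
    have "(LINT x|lborel. norm (g m x)) \<le> (LINT x::real|lborel. indicat_real {0..1} x * norm (e (Suc m)))" for m
      by (rule integral_mono) (use int bound in auto)
    then have "norm (LINT x|lborel. norm (g m x)) \<le> norm (e (Suc m))" for m
      by simp
    then show "summable (\<lambda>m. LINT x|lborel. norm (g m x))"
      by (intro summable_comparison_test[OF _ summ]) auto
  qed
  moreover have "(\<Sum>m. g m x) = 0" for x
  proof -
    have "(\<lambda>m. of_real (indicat_real {0..1} x * h k x) * (e (Suc m) * of_real (h (Suc m) x))) sums
       (of_real (indicat_real {0..1} x * h k x) * 0)"
      using zero[of x] unfolding h_def by (rule sums_mult)
    have "(\<lambda>m. g m x) sums 0"
      using \<open>(\<lambda>m. _ * (e (Suc m) * _)) sums _\<close> by (simp add: g_def mult_ac)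
    then show ?thesis by (rule sums_unique[symmetric])
  qed
  ultimately have "(\<lambda>m. e (Suc m) * of_real (if Suc m = k then 1 / 2 else 0)) sums 0"
    using has_bochner_integral_integral_eq[OF hb] by simp
  moreover have "(\<lambda>m. e (Suc m) * of_real (if Suc m = k then 1 / 2 else 0)) sums (e k / 2)"
  proof -
    have "(\<lambda>m. e (Suc m) * of_real (if Suc m = k then 1 / 2 else 0)) =
          (\<lambda>m. if m = k - 1 then e (Suc m) / 2 else 0)"
      using assms(3) by (auto simp: fun_eq_iff)
    then show ?thesis
      using sums_single[of "k - 1" "\<lambda>m. e (Suc m) / 2"] assms(3) by simp
  qed
  ultimately show ?thesis
    using sums_unique2 by fastforce
qed

section \<open>Convergence and uniqueness of the expansion of a form\<close>

text \<open>
  The case \<open>\<phi> = 0\<close> is the expansion of an even form, \<open>\<phi> = - pi / 2\<close> that of an odd one.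
\<close>

definition phase_expansion :: "real \<Rightarrow> complex \<Rightarrow> (nat \<Rightarrow> complex) \<Rightarrow> (complex \<Rightarrow> complex) \<Rightarrow> bool" where
  "phase_expansion \<phi> s a f \<longleftrightarrow> (\<forall>z\<in>uhp.
     (\<lambda>m. a (Suc m) / of_real (sqrt (real (Suc m))) * whittaker s (2 * pi * real (Suc m) * Im z) *
          of_real (cos (2 * pi * real (Suc m) * Re z + \<phi>))) sums f z)"

lemma cos_expansion_eq_phase_expansion: "cos_expansion R a f \<longleftrightarrow> phase_expansion 0 (\<i> * R) a f"
  by (simp add: cos_expansion_def phase_expansion_def Let_def)

lemma sin_expansion_eq_phase_expansion: "sin_expansion R a f \<longleftrightarrow> phase_expansion (- pi / 2) (\<i> * R) a f"
proof -
  have "cos (x + - pi / 2) = sin x" for x :: real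
    by (simp add: cos_diff)
  then show ?thesis
    by (simp add: sin_expansion_def phase_expansion_def Let_def del: of_nat_Suc)
qed

text \<open>
  The constant \<open>sqrt (pi / 2)\<close> of the asymptotics exceeds \<open>1\<close>. Such a lower bound is what turns information
  on the terms of an expansion into information on its coefficients.
\<close>

lemma eventually_norm_whittaker_ge:
  assumes "\<bar>Re s\<bar> \<le> 1 / 2"
  shows "\<forall>\<^sub>F y in at_top. norm (whittaker s y) \<ge> exp (- y)"
proof -
  have "((\<lambda>y. norm (of_real (exp y) * whittaker s y)) \<longlongrightarrow> norm (complex_of_real (sqrt (pi / 2)))) at_top"
    by (intro tendsto_norm whittaker_asymptotics assms)
  moreover have "norm (complex_of_real (sqrt (pi / 2))) > 1"
    using pi_gt3 by simp
  ultimately have "\<forall>\<^sub>F y in at_top. norm (of_real (exp y) * whittaker s y) > 1"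
    by (rule order_tendstoD(1))
  then show ?thesis
    by eventually_elim (auto simp: norm_mult exp_minus field_simps)
qed

text \<open>
  The terms at height \<open>\<epsilon> / (2 * pi)\<close> tend to zero, and the Whittaker function
  there is at least \<open>exp (- (\<epsilon> * n))\<close> for large \<open>n\<close>.
\<close>

lemma phase_expansion_coefficient_growth:
  assumes f: "phase_expansion \<phi> s a f" and s: "\<bar>Re s\<bar> \<le> 1 / 2" and "\<epsilon> > 0"
  shows "\<exists>C. \<forall>n. norm (a (Suc n) / of_real (sqrt (real (Suc n)))) \<le> C * exp (\<epsilon> * real (Suc n))"
proof -
  define b where "b = (\<lambda>n. a (Suc n) / complex_of_real (sqrt (real (Suc n))))"
  define c where "c = (\<lambda>n. b n * whittaker s (\<epsilon> * real (Suc n)))"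
  have "c \<longlonglongrightarrow> 0"
  proof (rule cantor_lebesgue)
    fix x :: real
    have "Complex x (\<epsilon> / (2 * pi)) \<in> uhp"
      using assms(3) by (simp add: uhp_def)
    then have "(\<lambda>n. c n * of_real (cos (2 * pi * real (Suc n) * x + \<phi>))) sums f (Complex x (\<epsilon> / (2 * pi)))"
      using f unfolding phase_expansion_def c_def b_def
      by (auto simp: mult_ac simp del: of_nat_Suc dest: bspec)
    then show "(\<lambda>n. c n * of_real (cos (2 * pi * real (Suc n) * x + \<phi>))) \<longlonglongrightarrow> 0"
      by (rule summable_LIMSEQ_zero[OF sums_summable])
  qed
  then have "\<forall>\<^sub>F n in sequentially. norm (c n) < 1"
    using order_tendstoD(2)[OF tendsto_norm, of c 0 sequentially 1] by simp
  moreover have "filterlim (\<lambda>n. \<epsilon> * real (Suc n)) at_top sequentially"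
    using assms(3) by real_asymp
  from eventually_compose_filterlim[OF eventually_norm_whittaker_ge[OF s] this]
  have "\<forall>\<^sub>F n in sequentially. norm (whittaker s (\<epsilon> * real (Suc n))) \<ge> exp (- (\<epsilon> * real (Suc n)))" .
  ultimately have "\<forall>\<^sub>F n in sequentially. norm (norm (b n) * exp (- (\<epsilon> * real (Suc n)))) \<le> norm (1::real)"
  proof eventually_elim
    case (elim n)
    have "norm (b n) * exp (- (\<epsilon> * real (Suc n))) \<le> norm (c n)"
      unfolding c_def norm_mult using elim(2) by (intro mult_left_mono) auto
    with elim(1) show ?case by simp
  qed
  then have "Bseq (\<lambda>n. norm (b n) * exp (- (\<epsilon> * real (Suc n))))"
    by (rule Bseq_eventually_mono) simp
  then obtain C where C: "\<And>n. norm (norm (b n) * exp (- (\<epsilon> * real (Suc n)))) \<le> C"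
    unfolding Bseq_def by blast
  have "norm (b n) \<le> C * exp (\<epsilon> * real (Suc n))" for n
    using C[of n] by (simp add: exp_minus field_simps del: of_nat_Suc)
  then show ?thesis unfolding b_def by blast
qed

text \<open>
  The choice of half the decay rate at height \<open>y\<close>, that is \<open>\<epsilon> = pi * y\<close>, leaves a geometric
  majorant.
\<close>

lemma phase_expansion_abs_summable:
  assumes f: "phase_expansion \<phi> s a f" and s: "\<bar>Re s\<bar> \<le> 1 / 2" and y: "y > 0"
  shows "summable (\<lambda>m. norm (a (Suc m) / of_real (sqrt (real (Suc m))) * whittaker s (2 * pi * real (Suc m) * y)))"
proof -
  obtain C where C: "\<And>n. norm (a (Suc n) / of_real (sqrt (real (Suc n)))) \<le> C * exp (pi * y * real (Suc n))"
    using phase_expansion_coefficient_growth[OF f s, of "pi * y"] y by auto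
  have "summable (\<lambda>m. (C * sqrt (pi / 2) * exp (- (pi * y))) * exp (- (pi * y)) ^ m)"
    using y by (intro summable_mult summable_geometric) auto
  then show ?thesis
  proof (rule summable_comparison_test[rotated], intro exI[of _ 0] allI impI)
    fix m
    have "norm (a (Suc m) / of_real (sqrt (real (Suc m))) * whittaker s (2 * pi * real (Suc m) * y)) \<le>
        (C * exp (pi * y * real (Suc m))) * (sqrt (pi / 2) * exp (- (2 * pi * real (Suc m) * y)))"
      unfolding norm_mult using y by (intro mult_mono' C norm_whittaker_le s) auto
    also have "\<dots> = C * sqrt (pi / 2) * (exp (pi * y * real (Suc m)) * exp (- (2 * pi * real (Suc m) * y)))"
      by (simp only: mult_ac)
    also have "exp (pi * y * real (Suc m)) * exp (- (2 * pi * real (Suc m) * y)) = exp (real (Suc m) * (- (pi * y)))"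
      by (simp flip: exp_add add: algebra_simps)
    also have "\<dots> = exp (- (pi * y)) * exp (- (pi * y)) ^ m"
      by (simp only: exp_of_nat_mult power_Suc)
    finally show "norm (norm (a (Suc m) / of_real (sqrt (real (Suc m))) * whittaker s (2 * pi * real (Suc m) * y)))
      \<le> (C * sqrt (pi / 2) * exp (- (pi * y))) * exp (- (pi * y)) ^ m"
      by (simp only: real_norm_def abs_norm_cancel mult_ac)
  qed
qed

lemma has_sum_pos_nat_iff: "(f has_sum S) {0<..} \<longleftrightarrow> ((\<lambda>m. f (Suc m)) has_sum S) UNIV"
proof -
  have "{0<..} = range Suc"
    by (auto simp: image_iff intro: Suc_pred[symmetric])
  then show ?thesis
    by (simp add: has_sum_reindex comp_def)
qed

lemma phase_expansion_has_sum:
  assumes f: "phase_expansion \<phi> s a f" and s: "\<bar>Re s\<bar> \<le> 1 / 2" and z: "z \<in> uhp"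
  shows "((\<lambda>n. a n / of_real (sqrt (real n)) * whittaker s (2 * pi * real n * Im z) *
            of_real (cos (2 * pi * real n * Re z + \<phi>))) has_sum f z) {0<..}"
  unfolding has_sum_pos_nat_iff
proof (rule norm_summable_imp_has_sum)
  have "Im z > 0" using z by (simp add: uhp_def)
  have *: "norm (w * of_real (cos x)) \<le> norm w" for w :: complex and x
    by (simp add: norm_mult mult_left_le)
  show "summable (\<lambda>n. norm (a (Suc n) / of_real (sqrt (real (Suc n))) * whittaker s (2 * pi * real (Suc n) * Im z) *
            of_real (cos (2 * pi * real (Suc n) * Re z + \<phi>))))"
    by (rule summable_comparison_test[OF _ phase_expansion_abs_summable[OF f s \<open>Im z > 0\<close>]])
       (unfold real_norm_def abs_norm_cancel, use * in blast)
qed (use f z in \<open>auto simp: phase_expansion_def\<close>)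

text \<open>
  Uniqueness is used at a height where the \<open>k\<close>-th Whittaker factor does not vanish; for small
  arguments it may vanish, since \<open>whittaker s\<close> oscillates near \<open>0\<close> for imaginary \<open>s \<noteq> 0\<close>.
\<close>

lemma phase_expansion_zero_imp:
  assumes f: "phase_expansion \<phi> s a (\<lambda>_. 0)" and s: "\<bar>Re s\<bar> \<le> 1 / 2" and "k > 0"
  shows "a k = 0"
proof -
  have "filterlim (\<lambda>y. 2 * pi * real k * y) at_top at_top"
    using assms(3) by real_asymp
  from eventually_compose_filterlim[OF eventually_norm_whittaker_ge[OF s] this] eventually_gt_at_top[of 0]
  have "\<forall>\<^sub>F y in at_top. norm (whittaker s (2 * pi * real k * y)) \<ge> exp (- (2 * pi * real k * y)) \<and> y > 0"
    by eventually_elim auto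
  then obtain y where y: "norm (whittaker s (2 * pi * real k * y)) \<ge> exp (- (2 * pi * real k * y))" "y > 0"
    using eventually_happens'[OF trivial_limit_at_top_linorder] by blast
  have W: "whittaker s (2 * pi * real k * y) \<noteq> 0"
    using y(1) exp_gt_zero[of "- (2 * pi * real k * y)"] by (auto simp del: exp_gt_zero)
  define e where "e = (\<lambda>n. a n / of_real (sqrt (real n)) * whittaker s (2 * pi * real n * y))"
  have "e k = 0"
  proof (rule cos_series_coefficients_zero[OF _ _ assms(3)])
    show "summable (\<lambda>m. norm (e (Suc m)))"
      unfolding e_def by (rule phase_expansion_abs_summable[OF f s y(2)])
    fix x
    have *: "Complex x y \<in> uhp" using y by (simp add: uhp_def)
    show "(\<lambda>m. e (Suc m) * of_real (cos (2 * pi * real (Suc m) * x + \<phi>))) sums 0"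
      using bspec[OF f[unfolded phase_expansion_def] *] by (simp only: complex.sel e_def)
  qed
  with W show ?thesis using assms(3) by (simp add: e_def)
qed

section \<open>Hecke operators on expansions\<close>

text \<open>
  This is the real part of a geometric sum over the \<open>d\<close>-th roots of unity.
\<close>

lemma sum_cos_arithmetic_progression:
  fixes d m :: nat
  assumes "d > 0"
  shows "(\<Sum>b<d. cos (\<theta> + 2 * pi * real m * real b / real d)) = (if d dvd m then real d * cos \<theta> else 0)"
proof -
  define r where "r = cis (2 * pi * real m / real d)"
  have pow: "r ^ d = 1"
  proof -
    have "r ^ d = cis (real d * (2 * pi * real m / real d))"
      by (simp only: r_def Complex.DeMoivre)
    also have "real d * (2 * pi * real m / real d) = 2 * pi * real m"
      using assms by simp
    also have "cis (2 * pi * real m) = 1"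
      using cos_int_2pin[of "int m"] sin_int_2pin[of "int m"] by (simp add: complex_eq_iff)
    finally show ?thesis .
  qed
  have "cos (\<theta> + 2 * pi * real m * real b / real d) = Re (cis \<theta> * r ^ b)" for b
  proof -
    have "cis \<theta> * r ^ b = cis (\<theta> + real b * (2 * pi * real m / real d))"
      by (simp only: r_def Complex.DeMoivre cis_mult)
    also have "real b * (2 * pi * real m / real d) = 2 * pi * real m * real b / real d"
      by simp
    finally show ?thesis by simp
  qed
  then have "(\<Sum>b<d. cos (\<theta> + 2 * pi * real m * real b / real d)) = Re (cis \<theta> * (\<Sum>b<d. r ^ b))"
    unfolding sum_distrib_left Re_sum by simp
  also have "(\<Sum>b<d. r ^ b) = (if d dvd m then of_nat d else 0)"
  proof (cases "d dvd m")
    case True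
    then obtain j where "m = d * j" ..
    then have "r = 1"
      using assms cos_int_2pin[of "int j"] sin_int_2pin[of "int j"] by (simp add: r_def complex_eq_iff mult.assoc)
    with True show ?thesis by simp
  next
    case False
    have "r \<noteq> 1"
    proof
      assume "r = 1"
      then have "cos (2 * pi * real m / real d) = 1"
        by (simp add: r_def complex_eq_iff)
      then obtain j :: int where "2 * pi * real m / real d = of_int j * 2 * pi"
        unfolding cos_one_2pi_int by blast
      then have "real m = of_int j * real d"
        using assms by (simp add: field_simps)
      then have "int m = j * int d"
        by (metis of_int_eq_iff of_int_mult of_int_of_nat_eq)
      then have "int d dvd int m" by simp
      with False show False by simp
    qed
    then show ?thesis
      using False pow by (simp add: sum_gp_strict)
  qed
  finally show ?thesis by (simp)
qed

lemma has_sum_finite_sum: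
  fixes g :: "'b \<Rightarrow> 'a \<Rightarrow> complex"
  assumes "finite B" "\<And>b. b \<in> B \<Longrightarrow> (g b has_sum S b) A"
  shows "((\<lambda>x. \<Sum>b\<in>B. g b x) has_sum (\<Sum>b\<in>B. S b)) A"
  using assms by (induction B rule: finite_induct) (auto intro: has_sum_add)

text \<open>
  Summation over the translations \<open>b\<close> kills all frequencies \<open>m\<close> that are not divisible by \<open>d\<close>. The
  frequency \<open>m = d * j\<close> of \<open>f\<close> becomes the frequency \<open>k = a * j\<close>, with the Whittaker function at
  the argument \<open>2 * pi * k * Im z\<close> as in every expansion.
\<close>

lemma hecke_component_has_sum:
  fixes a d N :: nat
  assumes f: "phase_expansion \<phi> s c f" and s: "\<bar>Re s\<bar> \<le> 1 / 2" and z: "z \<in> uhp"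
    and a: "a > 0" and d: "d > 0"
  shows "((\<lambda>k. (if a dvd k then of_real (sqrt (real (a * d))) * c (d * (k div a)) else 0) / of_real (sqrt (real k)) *
            whittaker s (2 * pi * real k * Im z) * of_real (cos (2 * pi * real k * Re z + \<phi>)))
          has_sum (\<Sum>b<d. f ((of_nat a * z + of_nat b) / of_nat d))) {0<..}"
    (is "(?t has_sum _) _")
proof -
  define x y where "x = Re z" and "y = Im z"
  have y: "y > 0" using z by (simp add: uhp_def y_def)
  define F where "F = (\<lambda>m. c m / of_real (sqrt (real m)) * whittaker s (2 * pi * real m * (real a * y / real d)))"
  have pt: "Re ((of_nat a * z + of_nat b) / of_nat d) = (real a * x + real b) / real d"
       "Im ((of_nat a * z + of_nat b) / of_nat d) = real a * y / real d" for b
    by (simp_all add: x_def y_def)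
  have "((\<lambda>m. F m * of_real (cos (2 * pi * real m * ((real a * x + real b) / real d) + \<phi>)))
      has_sum f ((of_nat a * z + of_nat b) / of_nat d)) {0<..}" for b
  proof -
    have "(of_nat a * z + of_nat b) / of_nat d \<in> uhp"
      unfolding uhp_def mem_Collect_eq pt using y a d by simp
    from phase_expansion_has_sum[OF f s this] show ?thesis
      by (simp only: pt F_def)
  qed
  then have "((\<lambda>m. \<Sum>b<d. F m * of_real (cos (2 * pi * real m * ((real a * x + real b) / real d) + \<phi>)))
      has_sum (\<Sum>b<d. f ((of_nat a * z + of_nat b) / of_nat d))) {0<..}"
    by (intro has_sum_finite_sum) auto
  also have "(\<lambda>m. \<Sum>b<d. F m * of_real (cos (2 * pi * real m * ((real a * x + real b) / real d) + \<phi>))) =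
      (\<lambda>m. if d dvd m then F m * of_real (real d * cos (2 * pi * real m * real a * x / real d + \<phi>)) else 0)"
  proof
    fix m
    have arg: "2 * pi * real m * ((real a * x + real b) / real d) + \<phi> =
          (2 * pi * real m * real a * x / real d + \<phi>) + 2 * pi * real m * real b / real d" for b
      using d by (simp add: field_simps)
    show "(\<Sum>b<d. F m * of_real (cos (2 * pi * real m * ((real a * x + real b) / real d) + \<phi>))) =
      (if d dvd m then F m * of_real (real d * cos (2 * pi * real m * real a * x / real d + \<phi>)) else 0)"
      unfolding arg sum_distrib_left[symmetric] of_real_sum[symmetric] sum_cos_arithmetic_progression[OF d]
      by simp
  qed
  finally have sum1: "((\<lambda>m. if d dvd m then F m * of_real (real d * cos (2 * pi * real m * real a * x / real d + \<phi>)) else 0)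
      has_sum (\<Sum>b<d. f ((of_nat a * z + of_nat b) / of_nat d))) {0<..}" (is "(?g has_sum ?S) _") .
  have img: "(*) q ` {0<..} = {m. 0 < m \<and> q dvd m}" if "q > 0" for q :: nat
    using that by (auto simp: dvd_def)
  \<comment> \<open>First \<open>m = d * j\<close>, then \<open>k = a * j\<close>.\<close>
  have "(?g has_sum ?S) {m. 0 < m \<and> d dvd m}"
    using sum1 by (subst has_sum_cong_neutral[where T = "{0<..}" and g = ?g]) auto
  then have "((?g \<circ> (*) d) has_sum ?S) {0<..}"
    unfolding img[OF d, symmetric] using d by (subst (asm) has_sum_reindex) (auto simp: inj_on_def)
  also have "?this \<longleftrightarrow> ((?t \<circ> (*) a) has_sum ?S) {0<..}"
  proof (rule has_sum_cong)
    fix j :: nat assume "j \<in> {0<..}"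
    then have j: "j > 0" by simp
    have arg: "2 * pi * real (d * j) * (real a * y / real d) = 2 * pi * real (a * j) * y"
        "2 * pi * real (d * j) * real a * x / real d + \<phi> = 2 * pi * real (a * j) * x + \<phi>"
      using d by (simp_all)
    have "real d / sqrt (real (d * j)) = sqrt (real (a * d)) / sqrt (real (a * j))"
      using a d j by (simp add: real_sqrt_mult field_simps)
    then have coeff: "complex_of_real (real d) / of_real (sqrt (real (d * j))) =
        of_real (sqrt (real (a * d))) / of_real (sqrt (real (a * j)))"
      by (metis of_real_divide)
    have "(?g \<circ> (*) d) j = of_real (real d) / of_real (sqrt (real (d * j))) * (c (d * j) *
        whittaker s (2 * pi * real (a * j) * y) * of_real (cos (2 * pi * real (a * j) * x + \<phi>)))"
      unfolding comp_def F_def arg by (simp add: arg mult_ac)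
    also have "\<dots> = (?t \<circ> (*) a) j"
      unfolding coeff using a by (simp add: x_def y_def)
    finally show "(?g \<circ> (*) d) j = (?t \<circ> (*) a) j" .
  qed
  finally have "(?t has_sum ?S) {m. 0 < m \<and> a dvd m}"
    unfolding img[OF a, symmetric] using a by (subst has_sum_reindex) (auto simp: inj_on_def)
  then show ?thesis
    by (subst has_sum_cong_neutral[where T = "{m. 0 < m \<and> a dvd m}" and g = ?t]) auto
qed

lemma phase_expansion_hecke:
  assumes f: "phase_expansion \<phi> s c f" and s: "\<bar>Re s\<bar> \<le> 1 / 2" and n: "n > 0"
  shows "phase_expansion \<phi> s
     (\<lambda>k. \<Sum>a | a dvd n \<and> coprime a N. if a dvd k then c (n div a * (k div a)) else 0) (hecke N n f)"
  unfolding phase_expansion_def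
proof
  fix z assume z: "z \<in> uhp"
  let ?A = "{a. a dvd n \<and> coprime a N}"
  let ?e = "\<lambda>k. whittaker s (2 * pi * real k * Im z) * of_real (cos (2 * pi * real k * Re z + \<phi>))"
  have sqrt: "complex_of_real (sqrt (real n)) \<noteq> 0" using n by simp
  have "((\<lambda>k. (if a dvd k then of_real (sqrt (real n)) * c (n div a * (k div a)) else 0) / of_real (sqrt (real k)) * ?e k)
     has_sum (\<Sum>b<n div a. f ((of_nat a * z + of_nat b) / of_nat (n div a)))) {0<..}" if "a \<in> ?A" for a
  proof -
    have "a * (n div a) = n" "a > 0" "n div a > 0"
      using that n by (auto intro!: Nat.gr0I simp: dvd_div_eq_0_iff)
    with hecke_component_has_sum[OF f s z, of a "n div a"] show ?thesis
      by (simp only: mult.assoc)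
  qed
  then have "((\<lambda>k. 1 / of_real (sqrt (real n)) * (\<Sum>a\<in>?A. (if a dvd k then of_real (sqrt (real n)) * c (n div a * (k div a)) else 0) / of_real (sqrt (real k)) * ?e k))
     has_sum hecke N n f z) {0<..}"
    unfolding hecke_def using n by (intro has_sum_cmult_right has_sum_finite_sum) auto
  also have "(\<lambda>k. 1 / of_real (sqrt (real n)) * (\<Sum>a\<in>?A. (if a dvd k then of_real (sqrt (real n)) * c (n div a * (k div a)) else 0) / of_real (sqrt (real k)) * ?e k))
     = (\<lambda>k. (\<Sum>a\<in>?A. if a dvd k then c (n div a * (k div a)) else 0) / of_real (sqrt (real k)) * ?e k)"
    unfolding sum_distrib_left sum_divide_distrib sum_distrib_right
    using sqrt by (intro ext sum.cong) auto
  finally show "(\<lambda>m. (\<Sum>a\<in>?A. if a dvd Suc m then c (n div a * (Suc m div a)) else 0) /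
          of_real (sqrt (real (Suc m))) * whittaker s (2 * pi * real (Suc m) * Im z) *
          of_real (cos (2 * pi * real (Suc m) * Re z + \<phi>))) sums hecke N n f z"
    unfolding has_sum_pos_nat_iff by (intro has_sum_imp_sums) (simp only: mult.assoc)
qed

text \<open>
  The difference of the Hecke transform and the multiple of \<open>f\<close> is an expansion of zero, so that
  uniqueness gives an identity for each index \<open>k\<close>; the index \<open>1\<close> identifies the Hecke eigenvalue as \<open>c n\<close>.
\<close>

lemma hecke_relation:
  assumes f: "phase_expansion \<phi> s c f" and s: "\<bar>Re s\<bar> \<le> 1 / 2"
    and hecke: "hecke_eigenform N f" and c1: "c 1 = 1" and n: "n > 0" and k: "k > 0"
  shows "c n * c k = (\<Sum>a | a dvd n \<and> coprime a N. if a dvd k then c (n div a * (k div a)) else 0)"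
proof -
  define T where "T = (\<lambda>k. \<Sum>a | a dvd n \<and> coprime a N. if a dvd k then c (n div a * (k div a)) else 0)"
  obtain l where l: "\<And>z. z \<in> uhp \<Longrightarrow> hecke N n f z = l * f z"
    using hecke n unfolding hecke_eigenform_def by (metis One_nat_def Suc_leI)
  \<comment> \<open>Convergence of the difference is only known pointwise, which is all that uniqueness needs.\<close>
  have "phase_expansion \<phi> s (\<lambda>k. T k - l * c k) (\<lambda>_. 0)"
    unfolding phase_expansion_def
  proof
    fix z assume z: "z \<in> uhp"
    let ?e = "\<lambda>m. whittaker s (2 * pi * real (Suc m) * Im z) * of_real (cos (2 * pi * real (Suc m) * Re z + \<phi>))"
    have "(\<lambda>m. T (Suc m) / of_real (sqrt (real (Suc m))) * ?e m) sums hecke N n f z"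
      using phase_expansion_hecke[OF f s n, of N] z unfolding phase_expansion_def T_def mult.assoc by blast
    moreover have "(\<lambda>m. l * (c (Suc m) / of_real (sqrt (real (Suc m))) * ?e m)) sums (l * f z)"
      using f z unfolding phase_expansion_def mult.assoc by (intro sums_mult) blast
    ultimately have "(\<lambda>m. T (Suc m) / of_real (sqrt (real (Suc m))) * ?e m - l * (c (Suc m) / of_real (sqrt (real (Suc m))) * ?e m))
       sums (hecke N n f z - l * f z)"
      by (rule sums_diff)
    then show "(\<lambda>m. (T (Suc m) - l * c (Suc m)) / of_real (sqrt (real (Suc m))) * whittaker s (2 * pi * real (Suc m) * Im z)
         * of_real (cos (2 * pi * real (Suc m) * Re z + \<phi>))) sums 0"
      by (simp add: l[OF z] diff_divide_distrib algebra_simps del: of_nat_Suc)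
  qed
  from phase_expansion_zero_imp[OF this s]
  have *: "T k = l * c k" if "k > 0" for k using that by fastforce
  have "T 1 = (\<Sum>a | a dvd n \<and> coprime a N. if a = 1 then c n else 0)"
    unfolding T_def by (intro sum.cong) auto
  also have "\<dots> = c n"
    using n by (subst sum.delta) auto
  finally have "l = c n"
    using *[of 1] c1 by simp
  with *[OF k] show ?thesis by (simp add: T_def)
qed

section \<open>The bound for the coefficients\<close>

text \<open>
  The largest absolute value that the bounds on \<open>\<alpha>\<close> allow for the \<open>p ^ k\<close>-th coefficient
  \<open>\<alpha> ^ k + \<alpha> ^ (k - 2) + \<dots> + \<alpha> ^ (- k)\<close>; the constant \<open>theta\<close> is built from these local factors.
\<close>

definition satake_sum :: "nat \<Rightarrow> nat \<Rightarrow> real" where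
  "satake_sum p k = (\<Sum>l=0..k. real p powr (7/64 * (real k - 2 * real l)))"

text \<open>
  The exponents are symmetric about zero, so \<open>exp\<close> may be replaced by \<open>cosh\<close>, which is
  monotone in the absolute value of its argument.
\<close>

lemma sum_exp_symmetric_mono:
  fixes t u :: real
  assumes "\<bar>t\<bar> \<le> u"
  shows "(\<Sum>l=0..k. exp ((real k - 2 * real l) * t)) \<le> (\<Sum>l=0..k. exp ((real k - 2 * real l) * u))"
proof -
  have sym: "(\<Sum>l=0..k. exp ((real k - 2 * real l) * v)) = (\<Sum>l=0..k. cosh ((real k - 2 * real l) * v))" for v :: real
  proof -
    have "(\<Sum>l=0..k. exp ((real k - 2 * real l) * v)) = (\<Sum>l=0..k. exp ((real k - 2 * real (k - l)) * v))"
      using sum.atLeastAtMost_rev[of "\<lambda>l. exp ((real k - 2 * real l) * v)" 0 k] by simp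
    also have "\<dots> = (\<Sum>l=0..k. exp (- ((real k - 2 * real l) * v)))"
      by (intro sum.cong) (auto simp: of_nat_diff algebra_simps)
    finally have "2 * (\<Sum>l=0..k. exp ((real k - 2 * real l) * v)) =
        (\<Sum>l=0..k. exp ((real k - 2 * real l) * v) + exp (- ((real k - 2 * real l) * v)))"
      by (simp add: sum.distrib)
    also have "\<dots> = (\<Sum>l=0..k. 2 * cosh ((real k - 2 * real l) * v))"
      by (intro sum.cong) (auto simp: cosh_field_def)
    finally show ?thesis by (simp flip: sum_distrib_left)
  qed
  have "cosh (x * t) \<le> cosh (x * u)" for x
  proof -
    have "cosh \<bar>x * t\<bar> \<le> cosh \<bar>x * u\<bar>"
      using assms by (subst cosh_real_nonneg_le_iff) (auto simp: abs_mult intro!: mult_left_mono)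
    then show ?thesis by (simp only: cosh_real_abs)
  qed
  then show ?thesis unfolding sym by (intro sum_mono)
qed

lemma satake_sum_eq_exp:
  assumes "p > 0"
  shows "satake_sum p k = (\<Sum>l=0..k. exp ((real k - 2 * real l) * (7/64 * ln (real p))))"
  unfolding satake_sum_def using assms by (intro sum.cong) (auto simp: powr_def mult_ac)

lemma norm_satake_sum_le:
  fixes \<alpha> :: complex
  assumes p: "p > 0" and \<alpha>: "real p powr (- 7/64) \<le> norm \<alpha>" "norm \<alpha> \<le> real p powr (7/64)"
  shows "norm (\<Sum>l=0..k. \<alpha> ^ (k - l) * inverse \<alpha> ^ l) \<le> satake_sum p k"
proof -
  define r where "r = norm \<alpha>"
  have r: "r > 0"
    using \<alpha>(1) p unfolding r_def by (auto simp: powr_def intro: less_le_trans[OF exp_gt_zero])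
  have "- (7/64 * ln (real p)) \<le> ln r" "ln r \<le> 7/64 * ln (real p)"
    using ln_mono[OF \<alpha>(1)] ln_mono[OF \<alpha>(2)] r p by (auto simp: r_def ln_powr)
  then have ln: "\<bar>ln r\<bar> \<le> 7/64 * ln (real p)" by simp
  have "norm (\<Sum>l=0..k. \<alpha> ^ (k - l) * inverse \<alpha> ^ l) \<le> (\<Sum>l=0..k. r ^ (k - l) * inverse r ^ l)"
    by (rule sum_norm_le) (simp add: norm_mult norm_power norm_inverse r_def)
  also have "\<dots> = (\<Sum>l=0..k. exp ((real k - 2 * real l) * ln r))"
  proof (rule sum.cong[OF refl])
    fix l assume "l \<in> {0..k}"
    then have "(real k - 2 * real l) * ln r = real (k - l) * ln r + real l * (- ln r)"
      by (simp add: of_nat_diff algebra_simps)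
    moreover have "exp (real (k - l) * ln r + real l * (- ln r)) = exp (ln r) ^ (k - l) * exp (- ln r) ^ l"
      by (simp only: exp_add exp_of_nat_mult)
    ultimately show "r ^ (k - l) * inverse r ^ l = exp ((real k - 2 * real l) * ln r)"
      using r by (simp add: exp_minus)
  qed
  also have "\<dots> \<le> satake_sum p k"
    unfolding satake_sum_eq_exp[OF p] by (rule sum_exp_symmetric_mono[OF ln])
  finally show ?thesis .
qed

lemma one_le_satake_sum:
  assumes "p > 0"
  shows "1 \<le> satake_sum p k"
proof -
  have "1 \<le> real p powr (7/64 * (real k - 2 * real (0::nat)))"
    using assms by (intro ge_one_powr_ge_zero) auto
  also have "\<dots> \<le> satake_sum p k"
    unfolding satake_sum_def by (rule member_le_sum) auto
  finally show ?thesis .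
qed

lemma satake_sum_le:
  assumes "p > 0"
  shows "satake_sum p k \<le> real (k + 1) * real p powr (7/64 * real k)"
proof -
  have "satake_sum p k \<le> (\<Sum>l=0..k. real p powr (7/64 * real k))"
    unfolding satake_sum_def using assms by (intro sum_mono powr_mono) auto
  then show ?thesis by simp
qed

lemma real_sqrt_prod: "sqrt (\<Prod>i\<in>A. f i) = (\<Prod>i\<in>A. sqrt (f i))"
  by (induction A rule: infinite_finite_induct) (auto simp: real_sqrt_mult)

lemma theta_eq: "theta = (SUP n\<in>{1::nat..}. 1 / sqrt (real n) * (\<Prod>p\<in>prime_factors n. satake_sum p (multiplicity p n)))"
  by (simp add: theta_def satake_sum_def)

text \<open>
  The local factor at \<open>p ^ k\<close> is at most \<open>(k + 1) * p powr (- 25/64 * k)\<close>. For \<open>p \<ge> 7\<close> this is at most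
  \<open>(k + 1) / 2 ^ k \<le> 1\<close>, because \<open>2 ^ 64 \<le> 7 ^ 25\<close>; for the smaller primes it is bounded in \<open>k\<close>.
\<close>

lemma theta_set_bdd_above:
  "bdd_above ((\<lambda>n. 1 / sqrt (real n) * (\<Prod>p\<in>prime_factors n. satake_sum p (multiplicity p n))) ` {1::nat..})"
proof -
  have "(\<lambda>k. (real k + 1) * 2 powr (- (25/64) * real k)) \<longlonglongrightarrow> 0"
    by real_asymp
  then have "Bseq (\<lambda>k. (real k + 1) * 2 powr (- (25/64) * real k))"
    by (intro convergent_imp_Bseq convergentI)
  then obtain C0 where C0: "\<And>k. norm ((real k + 1) * 2 powr (- (25/64) * real k)) \<le> C0"
    unfolding Bseq_def by blast
  define C where "C = max 1 C0"
  have C: "C \<ge> 1" "(real k + 1) * 2 powr (- (25/64) * real k) \<le> C" for k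
    using C0[of k] by (auto simp: C_def abs_mult)
  have factor: "satake_sum p k / sqrt (real p ^ k) \<le> (if p < 7 then C else 1)" if p: "p \<ge> 2" for p k :: nat
  proof -
    have "sqrt (real p ^ k) = real p powr (real k / 2)"
      using p by (simp add: powr_half_sqrt[symmetric] powr_powr flip: powr_realpow)
    then have "satake_sum p k / sqrt (real p ^ k) \<le> real (k + 1) * real p powr (7/64 * real k) / real p powr (real k / 2)"
      using satake_sum_le[of p k] p by (simp add: divide_right_mono)
    also have "\<dots> = (real k + 1) * real p powr (- (25/64) * real k)"
    proof -
      have "real p powr (7/64 * real k) / real p powr (real k / 2) = real p powr (7/64 * real k - real k / 2)"
        by (rule powr_diff[symmetric])
      also have "7/64 * real k - real k / 2 = - (25/64) * real k"
        by simp
      finally show ?thesis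
        by (simp only: times_divide_eq_right[symmetric] of_nat_add of_nat_1)
    qed
    finally have le: "satake_sum p k / sqrt (real p ^ k) \<le> (real k + 1) * real p powr (- (25/64) * real k)" .
    show ?thesis
    proof (cases "p < 7")
      case True
      have "real p powr (- (25/64) * real k) \<le> 2 powr (- (25/64) * real k)"
        using p by (intro powr_mono2') auto
      then have "(real k + 1) * real p powr (- (25/64) * real k) \<le> (real k + 1) * 2 powr (- (25/64) * real k)"
        by (intro mult_left_mono) auto
      from order_trans[OF le order_trans[OF this C(2)]] True show ?thesis
        by (simp only: if_True)
    next
      case False
      have pow: "x ^ j = x powr real j" if "x > 0" for x :: real and j
        using that by (rule powr_realpow[symmetric])
      have "(2::real) = (2 ^ 64) powr (1 / 64)"
        unfolding pow[of 2 64, OF zero_less_numeral] powr_powr by simp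
      also have "\<dots> \<le> (7 ^ 25) powr (1 / 64)"
        by (intro powr_mono2) auto
      also have "\<dots> = 7 powr (25 / 64)"
        unfolding pow[of 7 25, OF zero_less_numeral] powr_powr by simp
      also have "\<dots> \<le> real p powr (25 / 64)"
        using False by (intro powr_mono2) auto
      finally have "2 ^ k \<le> (real p powr (25 / 64)) ^ k"
        by (intro power_mono) auto
      also have "\<dots> = real p powr (25 / 64 * real k)"
        using p by (simp add: powr_powr flip: powr_realpow)
      finally have "2 ^ k \<le> real p powr (25 / 64 * real k)" .
      moreover have "real k + 1 \<le> 2 ^ k"
        using Suc_leI[OF less_exp[of k]] by (metis of_nat_Suc of_nat_le_iff of_nat_numeral of_nat_power add.commute)
      ultimately have "real k + 1 \<le> real p powr (25 / 64 * real k)" by linarith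
      then have "(real k + 1) * real p powr (- (25/64) * real k) \<le> 1"
        using p by (simp add: powr_minus field_simps)
      from order_trans[OF le this] False show ?thesis
        by (simp only: if_False)
    qed
  qed
  show ?thesis
  proof (rule bdd_aboveI2)
    fix n :: nat assume "n \<in> {1..}"
    then have n: "n > 0" by simp
    let ?P = "prime_factors n"
    have "n = (\<Prod>p\<in>?P. p ^ multiplicity p n)"
      using prod_prime_factors[of n] n by simp
    from arg_cong[OF this, of real]
    have "real n = (\<Prod>p\<in>?P. real p ^ multiplicity p n)" by simp
    from arg_cong[OF this, of sqrt]
    have "sqrt (real n) = (\<Prod>p\<in>?P. sqrt (real p ^ multiplicity p n))"
      by (simp only: real_sqrt_prod)
    then have "1 / sqrt (real n) * (\<Prod>p\<in>?P. satake_sum p (multiplicity p n)) =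
        (\<Prod>p\<in>?P. satake_sum p (multiplicity p n) / sqrt (real p ^ multiplicity p n))"
      by (simp add: prod_dividef)
    also have "\<dots> \<le> (\<Prod>p\<in>?P. if p < 7 then C else 1)"
    proof (intro prod_mono conjI)
      fix p assume "p \<in> ?P"
      then have p: "p \<ge> 2" by (auto intro: prime_ge_2_nat)
      show "0 \<le> satake_sum p (multiplicity p n) / sqrt (real p ^ multiplicity p n)"
        using one_le_satake_sum[of p "multiplicity p n"] p by simp
      show "satake_sum p (multiplicity p n) / sqrt (real p ^ multiplicity p n) \<le> (if p < 7 then C else 1)"
        by (rule factor[OF p])
    qed
    \<comment> \<open>Only the factors at primes below \<open>7\<close> contribute, and there are fewer than \<open>7\<close> of them.\<close>
    also have "\<dots> = C ^ card (?P \<inter> {p. p < 7})"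
      by (subst prod.If_cases) auto
    also have "\<dots> \<le> C ^ 7"
    proof (rule power_increasing)
      have "card (?P \<inter> {p. p < 7}) \<le> card {..<7::nat}"
        by (intro card_mono) auto
      then show "card (?P \<inter> {p. p < 7}) \<le> 7" by simp
    qed (use C in auto)
    finally show "1 / sqrt (real n) * (\<Prod>p\<in>?P. satake_sum p (multiplicity p n)) \<le> C ^ 7" .
  qed
qed

lemma hecke_prime_power_recurrence:
  fixes c :: "nat \<Rightarrow> complex"
  assumes c0: "c 1 = 1" and c1: "c p = \<alpha> + \<beta>" and prod: "\<alpha> * \<beta> = 1"
    and rec: "\<And>k. c p * c (p ^ Suc k) = c (p ^ Suc (Suc k)) + c (p ^ k)"
  shows "c (p ^ k) = (\<Sum>l=0..k. \<alpha> ^ (k - l) * \<beta> ^ l)"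
proof -
  define S where "S = (\<lambda>k. \<Sum>l=0..k. \<alpha> ^ (k - l) * \<beta> ^ l)"
  have S_Suc: "S (Suc k) = \<alpha> * S k + \<beta> ^ Suc k" for k
  proof -
    have "(\<Sum>l=0..k. \<alpha> ^ (Suc k - l) * \<beta> ^ l) = (\<Sum>l=0..k. \<alpha> * (\<alpha> ^ (k - l) * \<beta> ^ l))"
      by (intro sum.cong) (auto simp: Suc_diff_le)
    then show ?thesis by (simp add: S_def sum_distrib_left)
  qed
  have "c (p ^ k) = S k \<and> c (p ^ Suc k) = S (Suc k)"
  proof (induction k)
    case 0
    show ?case using c0 c1 by (simp add: S_def)
  next
    case (Suc k)
    have "c (p ^ Suc (Suc k)) = (\<alpha> + \<beta>) * S (Suc k) - (\<alpha> * \<beta>) * S k"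
      using rec[of k] Suc c1 prod by (simp add: algebra_simps)
    also have "\<dots> = S (Suc (Suc k))"
      by (simp add: S_Suc algebra_simps)
    finally show ?case using Suc by blast
  qed
  then show ?thesis by (simp add: S_def)
qed

text \<open>
  The relations give multiplicativity, \<open>c (p ^ k) = c p ^ k\<close> for \<open>p dvd N\<close>, and the three-term
  recurrence for the other primes, which reduces the bound to prime powers.
\<close>

lemma hecke_coefficient_bound:
  fixes c :: "nat \<Rightarrow> complex"
  assumes rel: "\<And>n k. n > 0 \<Longrightarrow> k > 0 \<Longrightarrow>
        c n * c k = (\<Sum>a | a dvd n \<and> coprime a N. if a dvd k then c (n div a * (k div a)) else 0)"
    and c1: "c 1 = 1"
    and bad: "\<And>p. prime p \<Longrightarrow> p dvd N \<Longrightarrow> norm (c p) \<le> 1"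
    and good: "\<And>p. prime p \<Longrightarrow> \<not> p dvd N \<Longrightarrow>
          \<exists>\<alpha>. c p = \<alpha> + inverse \<alpha> \<and>
              real p powr (- 7/64) \<le> norm \<alpha> \<and> norm \<alpha> \<le> real p powr (7/64)"
    and n: "n > 0"
  shows "norm (c n) \<le> (\<Prod>p\<in>prime_factors n. satake_sum p (multiplicity p n))"
proof -
  have mult: "c (m * n) = c m * c n" if "coprime m n" "m > 0" "n > 0" for m n
  proof -
    have "a dvd m \<and> a dvd n \<longleftrightarrow> a = 1" for a
      using that(1) by (metis coprime_common_divisor_nat one_dvd)
    then have "c m * c n = (\<Sum>a | a dvd m \<and> coprime a N. if a = 1 then c (m * n) else 0)"
      unfolding rel[OF that(2,3)] by (intro sum.cong) auto
    also have "\<dots> = c (m * n)"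
      using that(2) by (subst sum.delta) auto
    finally show ?thesis by simp
  qed
  have pp: "norm (c (p ^ k)) \<le> satake_sum p k" if p: "prime p" for p k
  proof (cases "p dvd N")
    case True
    have p0: "p > 0" using p by (simp add: prime_gt_0_nat)
    have "{a. a dvd p \<and> coprime a N} = {1}"
      using True p by (auto simp: prime_nat_iff coprime_absorb_left)
    then have "c (p ^ Suc k) = c p * c (p ^ k)" for k
      using rel[of p "p ^ k"] p0 by simp
    then have "c (p ^ k) = c p ^ k"
      using c1 by (induction k) auto
    then have "norm (c (p ^ k)) \<le> 1"
      using bad[OF p True] by (simp add: norm_power power_le_one)
    with one_le_satake_sum[OF p0, of k] show ?thesis by linarith
  next
    case False
    have p0: "p > 0" using p by (simp add: prime_gt_0_nat)
    have p1: "p \<noteq> 1" using p by auto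
    obtain \<alpha> where \<alpha>: "c p = \<alpha> + inverse \<alpha>" "real p powr (- 7/64) \<le> norm \<alpha>" "norm \<alpha> \<le> real p powr (7/64)"
      using good[OF p False] by blast
    have "\<alpha> \<noteq> 0"
      using \<alpha>(2) p0 by auto
    have set: "{a. a dvd p \<and> coprime a N} = {1, p}"
      using False p by (auto simp: prime_nat_iff prime_imp_coprime)
    have "c p * c (p ^ Suc k) = c (p ^ Suc (Suc k)) + c (p ^ k)" for k
      using rel[of p "p ^ Suc k"] p0 p1 unfolding set by simp
    from hecke_prime_power_recurrence[OF c1 \<alpha>(1) _ this, of k] \<open>\<alpha> \<noteq> 0\<close>
    have "c (p ^ k) = (\<Sum>l=0..k. \<alpha> ^ (k - l) * inverse \<alpha> ^ l)" by simp
    with norm_satake_sum_le[OF p0 \<alpha>(2,3)] show ?thesis by simp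
  qed
  let ?e = "\<lambda>p. multiplicity p n"
  have "c (\<Prod>p\<in>P. p ^ ?e p) = (\<Prod>p\<in>P. c (p ^ ?e p))" if "finite P" "\<And>p. p \<in> P \<Longrightarrow> prime p" for P
    using that
  proof (induction P rule: finite_induct)
    case empty
    then show ?case using c1 by simp
  next
    case (insert q P)
    have "coprime (q ^ ?e q) (\<Prod>p\<in>P. p ^ ?e p)"
    proof (rule prod_coprime_right)
      fix p assume "p \<in> P"
      then have "coprime q p"
        using insert by (intro primes_coprime) auto
      then show "coprime (q ^ ?e q) (p ^ ?e p)" by simp
    qed
    moreover have "(\<Prod>p\<in>P. p ^ ?e p) > 0" "q ^ ?e q > 0"
      using insert by (auto intro!: prod_pos simp: prime_gt_0_nat)
    ultimately show ?case
      using insert mult by simp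
  qed
  from this[of "prime_factors n"] have "c n = (\<Prod>p\<in>prime_factors n. c (p ^ ?e p))"
    using prod_prime_factors[of n] n by auto
  then show ?thesis
    using pp by (auto simp: prod_norm[symmetric] prime_factors_dvd intro!: prod_mono)
qed

lemma norm_coefficient_le_theta:
  fixes c :: "nat \<Rightarrow> complex"
  assumes "norm (c n) \<le> (\<Prod>p\<in>prime_factors n. satake_sum p (multiplicity p n))" and "n > 0"
  shows "norm (c n / of_real (sqrt (real n))) \<le> theta"
proof -
  have "norm (c n / of_real (sqrt (real n))) \<le> 1 / sqrt (real n) * (\<Prod>p\<in>prime_factors n. satake_sum p (multiplicity p n))"
    using assms by (simp add: norm_divide divide_right_mono)
  also have "\<dots> \<le> theta"
    unfolding theta_eq using assms(2) by (intro cSUP_upper theta_set_bdd_above) auto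
  finally show ?thesis .
qed

section \<open>The sign and the spectral parameter\<close>

lemma squarefree_prod_prime_factors:
  fixes N :: nat
  assumes "squarefree N" "N > 0"
  shows "\<Prod>(prime_factors N) = N"
proof -
  have "N = (\<Prod>p\<in>prime_factors N. p ^ multiplicity p N)"
    using prod_prime_factors[of N] assms(2) by simp
  also have "\<dots> = (\<Prod>p\<in>prime_factors N. p)"
  proof (rule prod.cong[OF refl])
    fix p assume p: "p \<in> prime_factors N"
    then have "multiplicity p N \<le> 1"
      using assms by (auto simp: squarefree_factorial_semiring' prime_factors_dvd)
    moreover have "multiplicity p N > 0"
      using p by (auto simp: prime_factors_multiplicity)
    ultimately have "multiplicity p N = 1" by linarith
    then show "p ^ multiplicity p N = p" by simp
  qed
  finally show ?thesis by simp
qed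

lemma atkin_lehner_sign:
  fixes a :: "nat \<Rightarrow> complex"
  assumes N: "N > 0" "squarefree N"
    and al: "\<And>p. prime p \<Longrightarrow> p dvd N \<Longrightarrow>
          a p = of_real (1 / sqrt (real p)) \<or> a p = - of_real (1 / sqrt (real p))"
  shows "of_int (moebius_mu N) * of_real (sqrt (real N)) * (\<Prod>p\<in>prime_factors N. a p) =
          (\<Prod>p\<in>prime_factors N. sgn (- a p))"
    and "(\<Prod>p\<in>prime_factors N. sgn (- a p)) \<in> {1, -1}"
proof -
  let ?P = "prime_factors N"
  have sgn: "sgn (- a p) = - 1 * of_real (sqrt (real p)) * a p \<and> sgn (- a p) \<in> {1, -1}" if "p \<in> ?P" for p
  proof -
    have p: "prime p" "p dvd N" "p > 0"
      using that by (auto intro: prime_gt_0_nat)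
    have "sgn (complex_of_real (1 / sqrt (real p))) = 1" "sgn (- complex_of_real (1 / sqrt (real p))) = - 1"
      unfolding sgn_minus sgn_of_real using p(3) by simp_all
    then show ?thesis
      using al[OF p(1,2)] p(3) by auto
  qed
  have "sqrt (real N) = (\<Prod>p\<in>?P. sqrt (real p))"
    using arg_cong[OF squarefree_prod_prime_factors[OF N(2,1)], of "\<lambda>n. sqrt (real n)"]
    by (simp add: real_sqrt_prod)
  then have "complex_of_real (sqrt (real N)) = (\<Prod>p\<in>?P. of_real (sqrt (real p)))"
    by simp
  moreover have "of_int (moebius_mu N) = (\<Prod>p\<in>?P. - 1 :: complex)"
    using N by (simp add: moebius_mu_def)
  ultimately have "of_int (moebius_mu N) * of_real (sqrt (real N)) * (\<Prod>p\<in>?P. a p) =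
      (\<Prod>p\<in>?P. - 1 * of_real (sqrt (real p)) * a p)"
    by (simp only: prod.distrib)
  also have "\<dots> = (\<Prod>p\<in>?P. sgn (- a p))"
    using sgn by (intro prod.cong) auto
  finally show "of_int (moebius_mu N) * of_real (sqrt (real N)) * (\<Prod>p\<in>?P. a p) = (\<Prod>p\<in>?P. sgn (- a p))" .
  have "(\<Prod>p\<in>Q. sgn (- a p)) \<in> {1, -1}" if "finite Q" "Q \<subseteq> ?P" for Q
    using that
  proof (induction Q rule: finite_induct)
    case (insert q Q)
    then show ?case using sgn[of q] by auto
  qed simp
  then show "(\<Prod>p\<in>?P. sgn (- a p)) \<in> {1, -1}" by simp
qed

text \<open>
  A real eigenvalue forces \<open>R\<close> to be real or imaginary, and positivity bounds the imaginary part.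
\<close>

lemma abs_Re_spectral_parameter_le:
  assumes "complex_of_real ev = 1/4 + R\<^sup>2" "ev > 0"
  shows "\<bar>Re (\<i> * R)\<bar> \<le> 1 / 2"
proof (cases "Im R = 0")
  case False
  have "Re R = 0"
    using arg_cong[OF assms(1), of Im] False by (simp add: power2_eq_square)
  moreover have "ev = 1/4 + ((Re R)\<^sup>2 - (Im R)\<^sup>2)"
    using arg_cong[OF assms(1), of Re] by (simp add: power2_eq_square)
  ultimately have "(Im R)\<^sup>2 \<le> (1/2)\<^sup>2"
    using assms(2) by (simp add: power2_eq_square)
  then have "\<bar>Im R\<bar> \<le> \<bar>1/2\<bar>"
    by (simp only: abs_le_square_iff)
  then show ?thesis by simp
qed simp

section \<open>Geometric tails\<close>

lemma geometric_tail_bound: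
  fixes t :: "nat \<Rightarrow> complex"
  assumes c: "c > 0" and t: "\<And>n. n > 0 \<Longrightarrow> norm (t n) \<le> K * exp (- (c * real n))"
  shows "norm (\<Sum>m. t (m + (M + 1))) \<le> K * exp (- (c * real M)) / (exp c - 1)"
proof -
  define q where "q = exp (- c)"
  have q: "q < 1" "q > 0" using c by (auto simp: q_def)
  have pow: "exp (- (c * real n)) = q ^ n" for n
    unfolding q_def exp_of_nat_mult[symmetric] by (simp add: mult.commute)
  have sums: "(\<lambda>m. (K * q ^ (M + 1)) * q ^ m) sums ((K * q ^ (M + 1)) * (1 / (1 - q)))"
    using q by (intro sums_mult geometric_sums) auto
  have le: "norm (t (m + (M + 1))) \<le> (K * q ^ (M + 1)) * q ^ m" for m
    using t[of "m + (M + 1)"] unfolding pow by (simp add: power_add mult_ac)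
  have "norm (\<Sum>m. t (m + (M + 1))) \<le> (K * q ^ (M + 1)) * (1 / (1 - q))"
    using norm_suminf_le[OF le sums_summable[OF sums]] unfolding sums_unique[OF sums, symmetric] .
  also have "\<dots> = K * q ^ M / (1 / q - 1)"
    using q by (simp add: field_simps)
  also have "\<dots> = K * exp (- (c * real M)) / (exp c - 1)"
    unfolding pow by (simp add: q_def exp_minus inverse_eq_divide)
  finally show ?thesis .
qed

lemma arithmetic_geometric_tail_bound:
  fixes t :: "nat \<Rightarrow> complex"
  assumes c: "c > 0" and t: "\<And>n. n > 0 \<Longrightarrow> norm (t n) \<le> K * real n * exp (- (c * real n))"
  shows "norm (\<Sum>m. t (m + (M + 1))) \<le>
           K * ((real M + 1) * exp c - real M) / (exp (c * real M) * (exp c - 1)\<^sup>2)"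
proof -
  define q where "q = exp (- c)"
  have q: "q < 1" "q > 0" using c by (auto simp: q_def)
  have pow: "exp (- (c * real n)) = q ^ n" for n
    unfolding q_def exp_of_nat_mult[symmetric] by (simp add: mult.commute)
  have sums: "(\<lambda>m. (K * q ^ (M + 1)) * (of_nat (Suc m) * q ^ m + real M * q ^ m)) sums
      ((K * q ^ (M + 1)) * (1 / (1 - q)\<^sup>2 + real M * (1 / (1 - q))))"
    using q by (intro sums_mult sums_add geometric_deriv_sums geometric_sums) auto
  have le: "norm (t (m + (M + 1))) \<le> (K * q ^ (M + 1)) * (of_nat (Suc m) * q ^ m + real M * q ^ m)" for m
    using t[of "m + (M + 1)"] unfolding pow by (simp add: power_add algebra_simps)
  have "norm (\<Sum>m. t (m + (M + 1))) \<le> (K * q ^ (M + 1)) * (1 / (1 - q)\<^sup>2 + real M * (1 / (1 - q)))"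
    using norm_suminf_le[OF le sums_summable[OF sums]] unfolding sums_unique[OF sums, symmetric] .
  also have "1 / (1 - q)\<^sup>2 + real M * (1 / (1 - q)) = (real M + 1 - real M * q) / (1 - q)\<^sup>2"
    using q by (simp add: power2_eq_square divide_simps) (simp add: algebra_simps)
  also have "(K * q ^ (M + 1)) * ((real M + 1 - real M * q) / (1 - q)\<^sup>2) =
      K * ((real M + 1) * (1 / q) - real M) / ((1 / q) ^ M * (1 / q - 1)\<^sup>2)"
  proof -
    have "1 / q - 1 = (1 - q) / q" "(real M + 1) * (1 / q) - real M = (real M + 1 - real M * q) / q"
      using q by (simp_all add: field_simps)
    moreover have "(K * (Q * q)) * (X / Y) = K * (X / q) / ((1 / Q) * (Y / q\<^sup>2))" if "Q > 0" "Y > 0" for Q X Y :: real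
      using q that by (simp add: power2_eq_square)
    from this[of "q ^ M" "(1 - q)\<^sup>2"]
    have "(K * q ^ (M + 1)) * (X / (1 - q)\<^sup>2) = K * (X / q) / ((1 / q) ^ M * ((1 - q) / q)\<^sup>2)" for X
      using q by (simp add: power_divide mult.commute[of q])
    ultimately show ?thesis by simp
  qed
  also have "1 / q = exp c"
    by (simp add: q_def exp_minus inverse_eq_divide)
  also have "exp c ^ M = exp (c * real M)"
    unfolding exp_of_nat_mult[symmetric] by (simp add: mult.commute)
  finally show ?thesis .
qed

section \<open>The Fricke relation on the imaginary axis\<close>

lemma cos_expansion_imaginary_axis:
  assumes "cos_expansion R a f" "v > 0"
  shows "(\<lambda>m. a (Suc m) / of_real (sqrt (real (Suc m))) * whittaker (\<i> * R) (2 * pi * real (Suc m) * v)) sums f (Complex 0 v)"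
proof -
  have "Complex 0 v \<in> uhp" using assms(2) by (simp add: uhp_def)
  from bspec[OF assms(1)[unfolded cos_expansion_def] this] show ?thesis
    by (simp add: Let_def del: of_nat_Suc)
qed

lemma fricke_imaginary_axis:
  assumes "N > 0" "v > 0"
  shows "- 1 / (of_nat N * Complex 0 v) = Complex 0 (1 / (real N * v))"
  using assms by (simp add: complex_eq_iff Re_divide Im_divide power2_eq_square)

text \<open>
  On the imaginary axis the difference quotient of \<open>f\<close> in the real direction is the series with
  \<open>sin (2 * pi * n * x) / x\<close>. These factors are at most \<open>2 * pi * n\<close> in absolute value,
  so the limit may be taken termwise.
\<close>

lemma sin_expansion_derivative:
  assumes f: "sin_expansion R a f" and s: "\<bar>Re (\<i> * R)\<bar> \<le> 1 / 2" and v: "v > 0"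
    and B: "\<And>n. n > 0 \<Longrightarrow> norm (a n / of_real (sqrt (real n))) \<le> B"
    and D: "(f has_derivative D) (at (Complex 0 v))" and f0: "f (Complex 0 v) = 0"
  shows "(\<lambda>m. a (Suc m) / of_real (sqrt (real (Suc m))) * whittaker (\<i> * R) (2 * pi * real (Suc m) * v) *
            of_real (2 * pi * real (Suc m))) sums D 1"
proof -
  define F where "F = (\<lambda>m. a (Suc m) / of_real (sqrt (real (Suc m))) * whittaker (\<i> * R) (2 * pi * real (Suc m) * v))"
  define g where "g = (\<lambda>m x. F m * of_real (sin (2 * pi * real (Suc m) * x) / x))"
  define M where "M = (\<lambda>m. norm (F m) * (2 * pi * real (Suc m)))"
  have "summable M"
  proof -
    have "summable (\<lambda>m. (B * sqrt (pi / 2) * (2 * pi) * exp (- (2 * pi * v))) * (of_nat (Suc m) * exp (- (2 * pi * v)) ^ m))"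
      using v by (intro summable_mult sums_summable[OF geometric_deriv_sums]) auto
    then show ?thesis
    proof (rule summable_comparison_test[rotated], intro exI[of _ 0] allI impI)
      fix m
      have "exp (- (2 * pi * real (Suc m) * v)) = exp (real (Suc m) * (- (2 * pi * v)))"
        by (simp add: mult_ac)
      also have "\<dots> = exp (- (2 * pi * v)) * exp (- (2 * pi * v)) ^ m"
        by (simp only: exp_of_nat_mult power_Suc)
      finally have e: "exp (- (2 * pi * real (Suc m) * v)) = exp (- (2 * pi * v)) * exp (- (2 * pi * v)) ^ m" .
      have "norm (F m) \<le> B * (sqrt (pi / 2) * exp (- (2 * pi * real (Suc m) * v)))"
        unfolding F_def norm_mult using v by (intro mult_mono' B norm_whittaker_le s) auto
      then have "M m \<le> (B * (sqrt (pi / 2) * exp (- (2 * pi * real (Suc m) * v)))) * (2 * pi * real (Suc m))"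
        unfolding M_def by (intro mult_right_mono) auto
      also have "\<dots> = (B * sqrt (pi / 2) * (2 * pi) * exp (- (2 * pi * v))) * (of_nat (Suc m) * exp (- (2 * pi * v)) ^ m)"
        unfolding e by (simp only: mult_ac)
      finally show "norm (M m) \<le> (B * sqrt (pi / 2) * (2 * pi) * exp (- (2 * pi * v))) * (of_nat (Suc m) * exp (- (2 * pi * v)) ^ m)"
        by (simp add: M_def abs_mult)
    qed
  qed
  have lim: "(g m \<longlongrightarrow> F m * of_real (2 * pi * real (Suc m))) (at 0)" for m
    unfolding g_def
  proof (intro tendsto_mult tendsto_const tendsto_of_real)
    have "((\<lambda>x. sin (2 * pi * real (Suc m) * x)) has_real_derivative 2 * pi * real (Suc m)) (at 0)"
      by (auto intro!: derivative_eq_intros)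
    then show "((\<lambda>x. sin (2 * pi * real (Suc m) * x) / x) \<longlongrightarrow> 2 * pi * real (Suc m)) (at 0)"
      by (simp add: DERIV_def del: of_nat_Suc)
  qed
  have bound: "norm (g m x) \<le> M m" for m x
  proof -
    have "\<bar>sin (2 * pi * real (Suc m) * x)\<bar> \<le> 2 * pi * real (Suc m) * \<bar>x\<bar>"
      using abs_sin_x_le_abs_x[of "2 * pi * real (Suc m) * x"] by (simp add: abs_mult del: of_nat_Suc)
    then have "\<bar>sin (2 * pi * real (Suc m) * x) / x\<bar> \<le> 2 * pi * real (Suc m)"
      by (cases "x = 0") (auto simp: divide_le_eq simp del: of_nat_Suc)
    then show ?thesis
      unfolding g_def M_def norm_mult norm_of_real by (intro mult_left_mono) auto
  qed
  have "\<forall>\<^sub>F (m, x) in sequentially \<times>\<^sub>F at 0. norm (g m x) \<le> M m"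
    by (intro always_eventually) (simp add: bound split_beta)
  from tannerys_theorem[where a = g, OF lim this \<open>summable M\<close> at_neq_bot]
  have tan: "summable (\<lambda>m. norm (F m * of_real (2 * pi * real (Suc m))))"
       "((\<lambda>x. \<Sum>m. g m x) \<longlongrightarrow> (\<Sum>m. F m * of_real (2 * pi * real (Suc m)))) (at 0)"
    by blast+
  have quot: "((\<lambda>x. f (Complex x v) / of_real x) \<longlongrightarrow> D 1) (at 0)"
  proof -
    have lin: "bounded_linear D" and D': "(\<lambda>h. norm (f (Complex 0 v + h) - f (Complex 0 v) - D h) / norm h) \<midarrow>0\<rightarrow> 0"
      using D by (auto simp: has_derivative_at)
    have "filterlim complex_of_real (at 0) (at 0)"
      unfolding filterlim_at by (auto intro!: tendsto_eq_intros simp: eventually_at_filter)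
    from filterlim_compose[OF D' this]
    have "((\<lambda>x. norm (f (Complex 0 v + of_real x) - D (of_real x)) / \<bar>x\<bar>) \<longlongrightarrow> 0) (at 0)"
      by (simp add: f0)
    moreover have "Complex 0 v + of_real x = Complex x v" for x
      by (simp add: complex_eq_iff)
    ultimately have lim0: "((\<lambda>x. norm (f (Complex x v) - D (of_real x)) / \<bar>x\<bar>) \<longlongrightarrow> 0) (at 0)"
      by simp
    have "norm (f (Complex x v) - D (of_real x)) / \<bar>x\<bar> = norm (f (Complex x v) / of_real x - D 1)" if "x \<noteq> 0" for x
    proof -
      have "D (of_real x) = of_real x * D 1"
        using linear_cmul[OF bounded_linear.linear[OF lin], of x 1] by (simp add: scaleR_conv_of_real)
      then have "f (Complex x v) / of_real x - D 1 = (f (Complex x v) - D (of_real x)) / of_real x"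
        using that by (simp add: diff_divide_distrib)
      then show ?thesis by (simp add: norm_divide)
    qed
    then have "\<forall>\<^sub>F x in at 0. norm (f (Complex x v) - D (of_real x)) / \<bar>x\<bar> = norm (f (Complex x v) / of_real x - D 1)"
      unfolding eventually_at_filter by (intro always_eventually allI impI)
    with lim0 have "((\<lambda>x. norm (f (Complex x v) / of_real x - D 1)) \<longlongrightarrow> 0) (at 0)"
      by (rule Lim_transform_eventually)
    then show ?thesis
      by (rule LIM_zero_cancel[OF tendsto_norm_zero_cancel])
  qed
  have "(\<Sum>m. g m x) = f (Complex x v) / of_real x" for x
  proof -
    have "Complex x v \<in> uhp" using v by (simp add: uhp_def)
    from bspec[OF f[unfolded sin_expansion_def] this]
    have "(\<lambda>m. F m * of_real (sin (2 * pi * real (Suc m) * x))) sums f (Complex x v)"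
      by (simp add: F_def Let_def del: of_nat_Suc)
    then have "(\<lambda>m. F m * of_real (sin (2 * pi * real (Suc m) * x)) / of_real x) sums (f (Complex x v) / of_real x)"
      by (rule sums_divide)
    then show ?thesis
      by (simp add: g_def sums_iff del: of_nat_Suc)
  qed
  with tan(2) quot have "(\<Sum>m. F m * of_real (2 * pi * real (Suc m))) = D 1"
    by (intro tendsto_unique[OF _ tan(2)]) auto
  with summable_norm_cancel[OF tan(1)] show ?thesis
    unfolding F_def by (simp add: sums_iff)
qed

text \<open>
  The chain rule: the complex derivative of \<open>- 1 / (N * z)\<close> is real on the imaginary axis, so the real
  direction is mapped to itself.
\<close>

lemma fricke_derivative:
  fixes f :: "complex \<Rightarrow> complex"
  assumes N: "N > 0" and v: "v > 0"
    and fricke: "\<And>z. z \<in> uhp \<Longrightarrow> f z = w * f (- 1 / (of_nat N * z))"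
    and D: "(f has_derivative D) (at (Complex 0 v))"
    and E: "(f has_derivative E) (at (Complex 0 (1 / (real N * v))))"
  shows "D 1 = - w / of_real (real N * v\<^sup>2) * E 1"
proof -
  define g where "g = (\<lambda>z::complex. - 1 / (of_nat N * z))"
  define r where "r = - 1 / (real N * v\<^sup>2)"
  have v0: "Complex 0 v \<noteq> 0" using v by (simp add: complex_eq_iff)
  have "(g has_field_derivative 1 / (of_nat N * (Complex 0 v)\<^sup>2)) (at (Complex 0 v))"
    unfolding g_def using N v0 by (auto intro!: derivative_eq_intros simp: power2_eq_square field_simps)
  also have "1 / (of_nat N * (Complex 0 v)\<^sup>2) = complex_of_real r"
  proof -
    have "(Complex 0 v)\<^sup>2 = - complex_of_real (v\<^sup>2)"
      by (simp add: complex_eq_iff power2_eq_square)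
    then show ?thesis by (simp add: r_def)
  qed
  finally have g: "(g has_derivative (*) (of_real r)) (at (Complex 0 v))"
    by (simp add: has_field_derivative_def)
  have gv: "g (Complex 0 v) = Complex 0 (1 / (real N * v))"
    unfolding g_def by (rule fricke_imaginary_axis[OF N v])
  have "((\<lambda>z. f (g z)) has_derivative (\<lambda>h. E (of_real r * h))) (at (Complex 0 v))"
    using has_derivative_compose[OF g, of f E] E by (simp add: gv)
  then have wE: "((\<lambda>z. w * f (g z)) has_derivative (\<lambda>h. w * E (of_real r * h))) (at (Complex 0 v))"
    by (rule has_derivative_mult_right)
  have "open uhp"
    unfolding uhp_def by (rule open_halfspace_Im_gt)
  then have "(f has_derivative (\<lambda>h. w * E (of_real r * h))) (at (Complex 0 v))"
    by (rule has_derivative_transform_within_open[OF wE, of uhp]) (use v fricke in \<open>auto simp: uhp_def g_def\<close>)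
  then have "D = (\<lambda>h. w * E (of_real r * h))"
    by (rule has_derivative_unique[OF D])
  moreover have "E (of_real r * 1) = of_real r * E 1"
    using linear_cmul[OF has_derivative_linear[OF E], of r 1] by (simp add: scaleR_conv_of_real)
  ultimately show ?thesis by (simp add: r_def)
qed

section \<open>The vanishing series\<close>

lemma even_series_sums_zero:
  assumes N: "N > 0" and w: "w = 1 \<or> w = -1" and f: "cos_expansion R a f"
    and fricke: "\<And>z. z \<in> uhp \<Longrightarrow> f z = w * f (- 1 / (of_nat N * z))"
  shows "(\<lambda>m. a (Suc m) / of_real (sqrt (real (Suc m))) *
            test_W True w N R (2 * pi * real (Suc m) / sqrt (real N))) sums 0"
proof -
  have sqrtN: "sqrt (real N) > 0" "sqrt (real N) * sqrt (real N) = real N" using N by auto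
  have axis: "f (Complex 0 v) = w * f (Complex 0 (1 / (real N * v)))" if "v > 0" for v
    using fricke[of "Complex 0 v"] that unfolding fricke_imaginary_axis[OF N that] by (simp add: uhp_def)
  show ?thesis
  proof (cases "w = -1")
    case True
    \<comment> \<open>The height fixed by the Fricke relation.\<close>
    define v where "v = 1 / sqrt (real N)"
    have v: "v > 0" "1 / (real N * v) = v"
      using sqrtN by (simp_all add: v_def field_simps)
    have "f (Complex 0 v) = 0"
      using axis[OF v(1)] True unfolding v(2) by simp
    with cos_expansion_imaginary_axis[OF f v(1)] show ?thesis
      using True by (simp add: test_W_def v_def del: of_nat_Suc)
  next
    case False
    \<comment> \<open>Two heights exchanged by the Fricke relation; the factor \<open>sqrt 2\<close> is the one in \<open>test_W\<close>.\<close>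
    define u v where "u = sqrt 2 / sqrt (real N)" and "v = 1 / (sqrt 2 * sqrt (real N))"
    have uv: "u > 0" "v > 0" "1 / (real N * u) = v"
      using sqrtN by (simp_all add: u_def v_def field_simps)
    have arg: "2 * pi * real (Suc m) / sqrt (real N) * sqrt 2 = 2 * pi * real (Suc m) * u"
        "2 * pi * real (Suc m) / sqrt (real N) / sqrt 2 = 2 * pi * real (Suc m) * v" for m
      by (simp_all add: u_def v_def)
    have "f (Complex 0 u) - f (Complex 0 v) = 0"
      using axis[OF uv(1)] w False unfolding uv(3) by simp
    with sums_diff[OF cos_expansion_imaginary_axis[OF f uv(1)] cos_expansion_imaginary_axis[OF f uv(2)]]
    show ?thesis
      using False unfolding test_W_def arg by (simp add: right_diff_distrib del: of_nat_Suc)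
  qed
qed

lemma odd_series_sums_zero:
  assumes N: "N > 0" and w: "w = 1 \<or> w = -1" and f: "sin_expansion R a f" and s: "\<bar>Re (\<i> * R)\<bar> \<le> 1 / 2"
    and B: "\<And>n. n > 0 \<Longrightarrow> norm (a n / of_real (sqrt (real n))) \<le> B"
    and odd: "odd_form f" and diff: "\<And>z. z \<in> uhp \<Longrightarrow> f differentiable (at z)"
    and fricke: "\<And>z. z \<in> uhp \<Longrightarrow> f z = w * f (- 1 / (of_nat N * z))"
  shows "(\<lambda>m. a (Suc m) / of_real (sqrt (real (Suc m))) *
            test_W False w N R (2 * pi * real (Suc m) / sqrt (real N))) sums 0"
proof -
  have sqrtN: "sqrt (real N) > 0" "sqrt (real N) * sqrt (real N) = real N" using N by auto
  define A where "A = (\<lambda>m. a (Suc m) / complex_of_real (sqrt (real (Suc m))))"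
  define L where "L = (\<lambda>v. frechet_derivative f (at (Complex 0 v)) 1)"
  have D: "(f has_derivative frechet_derivative f (at (Complex 0 v))) (at (Complex 0 v))" if "v > 0" for v
    using diff[of "Complex 0 v"] that by (simp add: frechet_derivative_works uhp_def)
  have L: "(\<lambda>m. A m * whittaker (\<i> * R) (2 * pi * real (Suc m) * v) * of_real (2 * pi * real (Suc m))) sums L v" if "v > 0" for v
    unfolding A_def L_def
  proof (rule sin_expansion_derivative[OF f s that B D[OF that]])
    have "- cnj (Complex 0 v) = Complex 0 v"
      by (simp add: complex_eq_iff)
    moreover have "f (- cnj (Complex 0 v)) = - f (Complex 0 v)"
      using odd that by (simp add: odd_form_def uhp_def)
    ultimately have "f (Complex 0 v) = - f (Complex 0 v)"
      by (simp only:)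
    then show "f (Complex 0 v) = 0" by simp
  qed
  have LL: "L v = - w / of_real (real N * v\<^sup>2) * L (1 / (real N * v))" if "v > 0" for v
    unfolding L_def
  proof (rule fricke_derivative[where f = f])
    show "f z = w * f (- 1 / (of_nat N * z))" if "z \<in> uhp" for z
      by (rule fricke[OF that])
  qed (use N that in \<open>auto intro!: D\<close>)
  have lin: "2 * pi * real (Suc m) / sqrt (real N) * sqrt (real N) / (2 * pi) = real (Suc m)" for m
    using sqrtN by simp
  show ?thesis
  proof (cases "w = 1")
    case True
    \<comment> \<open>The height fixed by the Fricke relation.\<close>
    define v where "v = 1 / sqrt (real N)"
    have v: "v > 0" "1 / (real N * v) = v" "real N * v\<^sup>2 = 1"
      using sqrtN by (simp_all add: v_def field_simps power2_eq_square)
    have "L v = 0"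
      using LL[OF v(1)] True unfolding v(2,3) by simp
    with sums_divide[OF L[OF v(1)], of "of_real (2 * pi)"] show ?thesis
      using True unfolding test_W_def lin by (simp add: A_def v_def mult_ac del: of_nat_Suc)
  next
    case False
    \<comment> \<open>Two heights exchanged by the Fricke relation; the factor \<open>sqrt 2\<close> is the one in \<open>test_W\<close>.\<close>
    define u v where "u = sqrt 2 / sqrt (real N)" and "v = 1 / (sqrt 2 * sqrt (real N))"
    have uv: "u > 0" "v > 0" "1 / (real N * u) = v" "real N * u\<^sup>2 = 2"
      using sqrtN by (simp_all add: u_def v_def field_simps power2_eq_square)
    have arg: "2 * pi * real (Suc m) / sqrt (real N) * sqrt 2 = 2 * pi * real (Suc m) * u"
        "2 * pi * real (Suc m) / sqrt (real N) / sqrt 2 = 2 * pi * real (Suc m) * v" for m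
      by (simp_all add: u_def v_def)
    have "w = -1" using w False by simp
    then have "(L u - 1 / 2 * L v) / of_real (2 * pi) = 0"
      using LL[OF uv(1)] unfolding uv(3,4) by simp
    with sums_divide[OF sums_diff[OF L[OF uv(1)] sums_mult[OF L[OF uv(2)], of "1 / 2"]], of "of_real (2 * pi)"]
    have "(\<lambda>m. (A m * whittaker (\<i> * R) (2 * pi * real (Suc m) * u) * of_real (2 * pi * real (Suc m)) -
       1 / 2 * (A m * whittaker (\<i> * R) (2 * pi * real (Suc m) * v) * of_real (2 * pi * real (Suc m)))) / of_real (2 * pi)) sums 0"
      by (simp only:)
    also have "(\<lambda>m. (A m * whittaker (\<i> * R) (2 * pi * real (Suc m) * u) * of_real (2 * pi * real (Suc m)) -
       1 / 2 * (A m * whittaker (\<i> * R) (2 * pi * real (Suc m) * v) * of_real (2 * pi * real (Suc m)))) / of_real (2 * pi))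
      = (\<lambda>m. A m * test_W False w N R (2 * pi * real (Suc m) / sqrt (real N)))"
    proof
      fix m
      have alg: "(b * x * (2 * p * r) - 1 / 2 * (b * y * (2 * p * r))) / (2 * p) = b * (r * (x - 1 / 2 * y))"
        if "p \<noteq> 0" for b x y p r :: complex
        using that by (simp add: field_simps)
      show "(A m * whittaker (\<i> * R) (2 * pi * real (Suc m) * u) * of_real (2 * pi * real (Suc m)) -
       1 / 2 * (A m * whittaker (\<i> * R) (2 * pi * real (Suc m) * v) * of_real (2 * pi * real (Suc m)))) / of_real (2 * pi)
      = A m * test_W False w N R (2 * pi * real (Suc m) / sqrt (real N))"
        unfolding test_W_def lin arg of_real_mult of_real_numeral
        using False by (subst alg) (simp_all del: of_nat_Suc)
    qed
    finally show ?thesis by (simp only: A_def)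
  qed
qed

section \<open>Bounds for the test function, and the theorem\<close>

lemma norm_test_W_le:
  assumes s: "\<bar>Re (\<i> * R)\<bar> \<le> 1 / 2" and N: "N > 0" and n: "n > 0"
  shows "norm (test_W is_even w N R (2 * pi * real n / sqrt (real N))) \<le> sqrt (pi / 2) *
    (if is_even then
       (if w = -1 then exp (- (2 * pi / sqrt (real N) * real n))
        else 2 * exp (- (pi * sqrt 2 / sqrt (real N) * real n)))
     else
       (if w = 1 then real n * exp (- (2 * pi / sqrt (real N) * real n))
        else real n * (3 / 2 * exp (- (pi * sqrt 2 / sqrt (real N) * real n)))))"
proof -
  define y where "y = 2 * pi * real n / sqrt (real N)"
  define E where "E = exp (- (pi * sqrt 2 / sqrt (real N) * real n))"
  have y: "y > 0" using N n by (simp add: y_def)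
  have lin: "y * sqrt (real N) / (2 * pi) = real n"
    using N by (simp add: y_def)
  have W1: "norm (whittaker (\<i> * R) y) \<le> sqrt (pi / 2) * exp (- (2 * pi / sqrt (real N) * real n))"
    using norm_whittaker_le[OF s y] by (simp add: y_def)
  have y2: "y / sqrt 2 > 0" using y by simp
  have eq: "y / sqrt 2 = pi * sqrt 2 / sqrt (real N) * real n"
    using N by (simp add: y_def field_simps)
  have W3: "norm (whittaker (\<i> * R) (y / sqrt 2)) \<le> sqrt (pi / 2) * E"
    unfolding E_def eq[symmetric] by (rule norm_whittaker_le[OF s y2])
  have "y / sqrt 2 \<le> y * sqrt 2"
    using y by (simp add: field_simps)
  then have "exp (- (y * sqrt 2)) \<le> E"
    unfolding E_def eq[symmetric] by simp
  then have le: "sqrt (pi / 2) * exp (- (y * sqrt 2)) \<le> sqrt (pi / 2) * E"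
    by (intro mult_left_mono) auto
  have y3: "y * sqrt 2 > 0" using y by simp
  have W2: "norm (whittaker (\<i> * R) (y * sqrt 2)) \<le> sqrt (pi / 2) * E"
    by (rule order_trans[OF norm_whittaker_le[OF s y3] le])
  have W23: "norm (whittaker (\<i> * R) (y * sqrt 2) - whittaker (\<i> * R) (y / sqrt 2)) \<le> sqrt (pi / 2) * (2 * E)"
    using norm_triangle_ineq4[of "whittaker (\<i> * R) (y * sqrt 2)" "whittaker (\<i> * R) (y / sqrt 2)"] W2 W3 by linarith
  have "norm (1 / 2 * whittaker (\<i> * R) (y / sqrt 2)) = 1 / 2 * norm (whittaker (\<i> * R) (y / sqrt 2))"
    by (simp add: norm_mult)
  then have W23': "norm (whittaker (\<i> * R) (y * sqrt 2) - 1 / 2 * whittaker (\<i> * R) (y / sqrt 2)) \<le> sqrt (pi / 2) * (3 / 2 * E)"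
    using norm_triangle_ineq4[of "whittaker (\<i> * R) (y * sqrt 2)" "1 / 2 * whittaker (\<i> * R) (y / sqrt 2)"] W2 W3 by linarith
  have scale: "norm (of_real (real n) * x) \<le> sqrt (pi / 2) * (real n * e)" if "norm x \<le> sqrt (pi / 2) * e" for x :: complex and e
    using mult_left_mono[OF that, of "real n"] by (simp add: norm_mult mult_ac)
  show ?thesis
    unfolding y_def[symmetric] test_W_def lin E_def[symmetric]
    using W1 W23 scale[OF W1] scale[OF W23'] by (simp del: of_real_of_nat_eq)
qed

theorem mainTheorem4:
  fixes N :: nat and ev :: real and R w :: complex
    and f :: "complex \<Rightarrow> complex" and a :: "nat \<Rightarrow> complex" and t :: "nat \<Rightarrow> complex"
  assumes N: "N > 0" "squarefree N"
    and eigenvalue: "complex_of_real ev = 1/4 + R\<^sup>2"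
    and newform: "maass_newform N ev f"
    and hecke: "hecke_eigenform N f"
    and parity: "even_form f \<or> odd_form f"
    and fourier_even: "even_form f \<Longrightarrow> cos_expansion R a f"
    and fourier_odd: "odd_form f \<Longrightarrow> sin_expansion R a f"
    and normalised: "a 1 = 1"
    and w_def: "w = of_int (moebius_mu N) * of_real (sqrt (real N)) * (\<Prod>p\<in>prime_factors N. a p)"
    (* Known facts: Atkin-Lehner theory and the Kim-Sarnak bound *)
    and atkin_lehner: "\<And>p. prime p \<Longrightarrow> p dvd N \<Longrightarrow>
          a p = of_real (1 / sqrt (real p)) \<or> a p = - of_real (1 / sqrt (real p))"
    and fricke: "\<And>z. z \<in> uhp \<Longrightarrow> f z = w * f (- 1 / (of_nat N * z))"
    and kim_sarnak: "\<And>p. prime p \<Longrightarrow> \<not> p dvd N \<Longrightarrow>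
          \<exists>\<alpha>. a p = \<alpha> + inverse \<alpha> \<and>
              real p powr (- 7/64) \<le> norm \<alpha> \<and> norm \<alpha> \<le> real p powr (7/64)"
    and t_def: "\<And>n. t n = a n / of_real (sqrt (real n)) *
          test_W (even_form f) w N R (2 * pi * real n / sqrt (real N))"
  shows "w = (\<Prod>p\<in>prime_factors N. sgn (- a p)) \<and> w \<in> {1, -1} \<and>
    (\<lambda>m. t (Suc m)) sums 0 \<and>
    (\<forall>M::nat. M \<ge> 1 \<longrightarrow> norm (\<Sum>m. t (m + (M + 1))) \<le>
      (if even_form f then
         (if w = -1 then
            theta * sqrt (pi/2) * exp (- (2 * pi * real M / sqrt (real N))) /
              (exp (2 * pi / sqrt (real N)) - 1)
          else
            2 * theta * sqrt (pi/2) * exp (- (pi * real M * sqrt 2 / sqrt (real N))) /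
              (exp (pi * sqrt 2 / sqrt (real N)) - 1))
       else
         (if w = 1 then
            theta * sqrt (pi/2) *
              ((real M + 1) * exp (2 * pi / sqrt (real N)) - real M) /
              (exp (2 * pi * real M / sqrt (real N)) * (exp (2 * pi / sqrt (real N)) - 1)\<^sup>2)
          else
            3 * theta / 2 * sqrt (pi/2) *
              ((real M + 1) * exp (pi * sqrt 2 / sqrt (real N)) - real M) /
              (exp (pi * real M * sqrt 2 / sqrt (real N)) *
                (exp (pi * sqrt 2 / sqrt (real N)) - 1)\<^sup>2))))"
proof -
  let ?r = "\<lambda>n. complex_of_real (sqrt (real n))"
  have cusp: "maass_cusp_form N ev f"
    using newform by (simp add: maass_newform_def)
  then have ev: "ev > 0" and smooth: "smooth_uhp f"
    by (auto simp: maass_cusp_form_def)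
  have diff: "f differentiable (at z)" if "z \<in> uhp" for z
    using smooth that unfolding smooth_uhp_def by (metis Ck_uhp.simps(2))
  have s: "\<bar>Re (\<i> * R)\<bar> \<le> 1 / 2"
    by (rule abs_Re_spectral_parameter_le[OF eigenvalue ev])
  obtain \<phi> where \<phi>: "phase_expansion \<phi> (\<i> * R) a f"
    using parity fourier_even fourier_odd
    unfolding cos_expansion_eq_phase_expansion sin_expansion_eq_phase_expansion by blast
  have bad: "norm (a p) \<le> 1" if "prime p" "p dvd N" for p
    using atkin_lehner[OF that] prime_ge_1_nat[OF that(1)] by (auto simp: norm_divide)
  have theta: "norm (a n / ?r n) \<le> theta" if "n > 0" for n
    using hecke_relation[OF \<phi> s hecke normalised] normalised bad kim_sarnak that
    by (intro norm_coefficient_le_theta hecke_coefficient_bound[where N = N]) blast+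
  have sign: "w = (\<Prod>p\<in>prime_factors N. sgn (- a p))" and w: "w \<in> {1, -1}"
    using atkin_lehner_sign[OF N atkin_lehner] w_def by auto
  have sums: "(\<lambda>m. t (Suc m)) sums 0"
  proof (cases "even_form f")
    case True
    then show ?thesis
      using even_series_sums_zero[OF N(1) _ fourier_even[OF True] fricke] w by (simp add: t_def del: of_nat_Suc)
  next
    case False
    with parity have odd: "odd_form f" by simp
    show ?thesis
      using odd_series_sums_zero[OF N(1) _ fourier_odd[OF odd] s theta odd diff fricke] w False
      by (simp add: t_def del: of_nat_Suc)
  qed
  define c1 where "c1 = 2 * pi / sqrt (real N)"
  define c2 where "c2 = pi * sqrt 2 / sqrt (real N)"
  have c: "c1 > 0" "c2 > 0" using N by (auto simp: c1_def c2_def)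
  have theta0: "theta \<ge> 0"
    using theta[of 1] normalised by simp
  have t: "norm (t n) \<le> theta * (sqrt (pi / 2) *
    (if even_form f then (if w = -1 then exp (- (c1 * real n)) else 2 * exp (- (c2 * real n)))
     else (if w = 1 then real n * exp (- (c1 * real n)) else real n * (3 / 2 * exp (- (c2 * real n))))))" if "n > 0" for n
    unfolding t_def norm_mult c1_def c2_def
    using norm_test_W_le[OF s N(1) that] theta0 by (intro mult_mono theta[OF that]) auto
  have M: "exp (- (2 * pi * real M / sqrt (real N))) = exp (- (c1 * real M))"
      "exp (- (pi * real M * sqrt 2 / sqrt (real N))) = exp (- (c2 * real M))"
      "exp (2 * pi * real M / sqrt (real N)) = exp (c1 * real M)"
      "exp (pi * real M * sqrt 2 / sqrt (real N)) = exp (c2 * real M)" for M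
    by (simp_all add: c1_def c2_def mult_ac)
  have tail: "norm (\<Sum>m. t (m + (M + 1))) \<le>
      (if even_form f then
         (if w = -1 then theta * sqrt (pi/2) * exp (- (c1 * real M)) / (exp c1 - 1)
          else 2 * theta * sqrt (pi/2) * exp (- (c2 * real M)) / (exp c2 - 1))
       else
         (if w = 1 then theta * sqrt (pi/2) * ((real M + 1) * exp c1 - real M) / (exp (c1 * real M) * (exp c1 - 1)\<^sup>2)
          else 3 * theta / 2 * sqrt (pi/2) * ((real M + 1) * exp c2 - real M) /
              (exp (c2 * real M) * (exp c2 - 1)\<^sup>2)))" for M
  proof (cases "even_form f"; cases "w = -1")
    assume *: "even_form f" "w = -1"
    with t show ?thesis
      using geometric_tail_bound[OF c(1), of t "theta * sqrt (pi/2)" M] by (simp add: mult_ac)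
  next
    assume *: "even_form f" "w \<noteq> -1"
    with t show ?thesis
      using geometric_tail_bound[OF c(2), of t "2 * theta * sqrt (pi/2)" M] by (simp add: mult_ac)
  next
    assume *: "\<not> even_form f" "w = -1"
    with t show ?thesis
      using arithmetic_geometric_tail_bound[OF c(2), of t "3 * theta / 2 * sqrt (pi/2)" M] by (simp add: mult_ac)
  next
    assume *: "\<not> even_form f" "w \<noteq> -1"
    with w have "w = 1" by simp
    with * t show ?thesis
      using arithmetic_geometric_tail_bound[OF c(1), of t "theta * sqrt (pi/2)" M] by (simp add: mult_ac)
  qed
  show ?thesis
    using sign w sums tail unfolding M c1_def[symmetric] c2_def[symmetric] by blast
qed

end
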